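(* Let $(R,\mathfrak{m})$ be a complete Noetherian local ring with residue field $k$ and $E=E_R(k)$. Let $I$ be an ideal with analytic spread $\ell$ and height $g$, satisfying $\mathrm{core}(I)=I(J^n:_R I^n)$ for some reduction $J$ of $I$, with reduction number $r$, and some natural number $n\geq\max\{r-\ell+g+1,1\}$. Then $$\mathrm{hull}^E(0:_E I)=\left(I\,(0:_E(J^n:_R I^{n-1})):_E I\right),$$ i.e. $\mathrm{hull}^E(0:_E I)$ is the $I$-basically full closure in $E$ of $(0:_E(J^n:_R I^{n-1}))$.
   Context: $E=E_R(k)$ is the injective hull of $k$ and $(-)^\vee=\mathrm{Hom}_R(-,E)$; by Matlis duality $E^\vee=R$, $R^\vee=E$, and for $A\subseteq E$, $(E/A)^\vee=(0:_R A)\subseteq R$. For an ideal $K$, $(0:_E K)=\{e\in E:Ke=0\}$. A reduction of $I$ is an ideal $J\subseteq I$ with $I^{s+1}=JI^s$ for some $s$; the reduction number of $I$ with respect to $J$ is the least such $s$. $\mathrm{core}(I)$ is the intersection of all reductions of $I$. For $L\subseteq M$ and an ideal $I$, $(L:_M I)=\{z\in M:Iz\subseteq L\}$, and the $I$-basically full closure of $L$ in $M$ is $(IL:_M I)$. The integral interior of $A\subseteq E$ is the dual of integral closure: $A^E_{-}:=\left(E^\vee/\left((E/A)^\vee\right)^{-}_{E^\vee}\right)^\vee=0:_E\overline{(0:_R A)}$, where $\overline{K}$ is the integral closure of the ideal $K$. $\mathrm{hull}^E(A)$ is the integral hull: the sum of all submodules $C$ with $A\subseteq C\subseteq E$ and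 $C^E_{-}=A^E_{-}$. *)

theory Defs
  imports "HOL-Algebra.Algebra" "HOL-Library.Extended_Nat"
begin

section \<open>Ideals\<close>

abbreviation ideal_power :: "('a, 'r) ring_scheme \<Rightarrow> 'a set \<Rightarrow> nat \<Rightarrow> 'a set" where
  "ideal_power R I n \<equiv> I [^]\<^bsub>ideals_set R\<^esub> n"

definition ideal_colon :: "('a, 'r) ring_scheme \<Rightarrow> 'a set \<Rightarrow> 'a set \<Rightarrow> 'a set" where
  "ideal_colon R A B = {x \<in> carrier R. \<forall>b\<in>B. b \<otimes>\<^bsub>R\<^esub> x \<in> A}"

definition reduction :: "('a, 'r) ring_scheme \<Rightarrow> 'a set \<Rightarrow> 'a set \<Rightarrow> bool" where
  "reduction R J I \<longleftrightarrow> ideal J R \<and> J \<subseteq> I \<and>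
     (\<exists>s. ideal_power R I (Suc s) = J \<cdot>\<^bsub>R\<^esub> ideal_power R I s)"

definition reduction_number :: "('a, 'r) ring_scheme \<Rightarrow> 'a set \<Rightarrow> 'a set \<Rightarrow> nat" where
  "reduction_number R J I =
     (LEAST s. ideal_power R I (Suc s) = J \<cdot>\<^bsub>R\<^esub> ideal_power R I s)"

definition core :: "('a, 'r) ring_scheme \<Rightarrow> 'a set \<Rightarrow> 'a set" where
  "core R I = \<Inter>{J. reduction R J I}"

definition integral_closure :: "('a, 'r) ring_scheme \<Rightarrow> 'a set \<Rightarrow> 'a set" where
  "integral_closure R K = {x \<in> carrier R. \<exists>n a. 1 \<le> n \<and>
     (\<forall>i\<in>{1..n}. a i \<in> ideal_power R K i) \<and>
     x [^]\<^bsub>R\<^esub> n \<oplus>\<^bsub>R\<^esub> (\<Oplus>\<^bsub>R\<^esub>i\<in>{1..n}. a i \<otimes>\<^bsub>R\<^esub> x [^]\<^bsub>R\<^esub> (n - i)) = \<zero>\<^bsub>R\<^esub>}"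


section \<open>Dimension, height, analytic spread\<close>

definition prime_chain :: "('a, 'r) ring_scheme \<Rightarrow> nat \<Rightarrow> (nat \<Rightarrow> 'a set) \<Rightarrow> bool" where
  "prime_chain R n P \<longleftrightarrow> (\<forall>i\<le>n. primeideal (P i) R) \<and> (\<forall>i<n. P i \<subset> P (Suc i))"

definition krull_dim :: "('a, 'r) ring_scheme \<Rightarrow> enat" where
  "krull_dim R = Sup {enat n | n. \<exists>P. prime_chain R n P}"

definition prime_height :: "('a, 'r) ring_scheme \<Rightarrow> 'a set \<Rightarrow> enat" where
  "prime_height R Q = Sup {enat n | n. \<exists>P. prime_chain R n P \<and> P n = Q}"

text \<open>The unit ideal has height \<open>\<infinity>\<close>.\<close>

definition ideal_height :: "('a, 'r) ring_scheme \<Rightarrow> 'a set \<Rightarrow> enat" where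
  "ideal_height R I = Inf {prime_height R Q | Q. primeideal Q R \<and> I \<subseteq> Q}"

text \<open>The Rees algebra is the subring \<open>R[It]\<close> of \<open>R[t]\<close>. The fiber cone, the direct sum of
  the modules \<open>I\<^sup>n / mI\<^sup>n\<close>, is \<open>R[It] / mR[It]\<close>: the degree \<open>n\<close> part of \<open>mR[It]\<close> is
  \<open>mI\<^sup>nt\<^sup>n\<close>.\<close>

definition rees_algebra :: "('a, 'r) ring_scheme \<Rightarrow> 'a set \<Rightarrow> ('a, nat \<Rightarrow> 'a) up_ring" where
  "rees_algebra R I = UP R
     \<lparr>carrier := {p \<in> carrier (UP R). \<forall>n. coeff (UP R) p n \<in> ideal_power R I n}\<rparr>"

definition fiber_cone :: "('a, 'r) ring_scheme \<Rightarrow> 'a set \<Rightarrow> 'a set \<Rightarrow> (nat \<Rightarrow> 'a) set ring" where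
  "fiber_cone R m I =
     rees_algebra R I Quot (Idl\<^bsub>rees_algebra R I\<^esub> ((\<lambda>a. monom (UP R) a 0) ` m))"

definition analytic_spread :: "('a, 'r) ring_scheme \<Rightarrow> 'a set \<Rightarrow> 'a set \<Rightarrow> enat" where
  "analytic_spread R m I = krull_dim (fiber_cone R m I)"


section \<open>Complete Noetherian local rings\<close>

definition adic_Cauchy :: "('a, 'r) ring_scheme \<Rightarrow> 'a set \<Rightarrow> (nat \<Rightarrow> 'a) \<Rightarrow> bool" where
  "adic_Cauchy R m x \<longleftrightarrow>
     (\<forall>N. \<exists>k. \<forall>i\<ge>k. \<forall>j\<ge>k. x i \<ominus>\<^bsub>R\<^esub> x j \<in> ideal_power R m N)"

definition adic_limit :: "('a, 'r) ring_scheme \<Rightarrow> 'a set \<Rightarrow> (nat \<Rightarrow> 'a) \<Rightarrow> 'a \<Rightarrow> bool" where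
  "adic_limit R m x y \<longleftrightarrow>
     (\<forall>N. \<exists>k. \<forall>i\<ge>k. x i \<ominus>\<^bsub>R\<^esub> y \<in> ideal_power R m N)"

locale complete_noetherian_local_ring = cring R + noetherian_ring R
  for R (structure) +
  fixes m :: "'a set"
  assumes maximal: "maximalideal m R"
    and maximal_unique: "maximalideal m' R \<Longrightarrow> m' = m"
    and separated: "(\<Inter>n. ideal_power R m n) = {\<zero>}"
    and complete: "\<lbrakk>x \<in> UNIV \<rightarrow> carrier R; adic_Cauchy R m x\<rbrakk> \<Longrightarrow>
      \<exists>y \<in> carrier R. adic_limit R m x y"


section \<open>Modules and injective hulls\<close>

definition module_hom ::
  "('a, 'r) ring_scheme \<Rightarrow> ('a, 'b, 's) module_scheme \<Rightarrow> ('a, 'c, 't) module_scheme \<Rightarrow> ('b \<Rightarrow> 'c) set"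
  where
  "module_hom R M N = {f \<in> carrier M \<rightarrow> carrier N.
     (\<forall>x\<in>carrier M. \<forall>y\<in>carrier M. f (x \<oplus>\<^bsub>M\<^esub> y) = f x \<oplus>\<^bsub>N\<^esub> f y) \<and>
     (\<forall>a\<in>carrier R. \<forall>x\<in>carrier M. f (a \<odot>\<^bsub>M\<^esub> x) = a \<odot>\<^bsub>N\<^esub> f x)}"

text \<open>A definition cannot quantify over all types, so the test modules have their elements in
  \<open>'a \<times> 'e\<close>. This type holds copies of \<open>R\<close> and its ideals and of \<open>E\<close> and its
  submodules; already the inclusions of ideals into \<open>R\<close> suffice, by Baer's criterion, for
  injectivity with respect to modules over any type.\<close>

definition injective_module :: "('a, 'r) ring_scheme \<Rightarrow> ('a, 'e, 's) module_scheme \<Rightarrow> bool" where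
  "injective_module R E \<longleftrightarrow> module R E \<and>
     (\<forall>(M :: ('a, 'a \<times> 'e) module) (N :: ('a, 'a \<times> 'e) module) i f.
        module R M \<and> module R N \<and>
        i \<in> module_hom R M N \<and> inj_on i (carrier M) \<and> f \<in> module_hom R M E \<longrightarrow>
        (\<exists>g \<in> module_hom R N E. \<forall>x\<in>carrier M. g (i x) = f x))"

definition injective_hull ::
  "('a, 'r) ring_scheme \<Rightarrow> ('a, 'b, 's) module_scheme \<Rightarrow> ('a, 'e, 't) module_scheme \<Rightarrow> bool" where
  "injective_hull R M E \<longleftrightarrow> injective_module R E \<and>
     (\<exists>f \<in> module_hom R M E. inj_on f (carrier M) \<and>
        (\<forall>N. submodule N R E \<and> N \<noteq> {\<zero>\<^bsub>E\<^esub>} \<longrightarrow> N \<inter> f ` carrier M \<noteq> {\<zero>\<^bsub>E\<^esub>}))"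

definition quotient_module :: "('a, 'r) ring_scheme \<Rightarrow> 'a set \<Rightarrow> ('a, 'a set) module" where
  "quotient_module R I =
     ring.extend (R Quot I) (module.fields (\<lambda>a C. (I +>\<^bsub>R\<^esub> a) \<otimes>\<^bsub>R Quot I\<^esub> C))"

definition module_colon ::
  "('a, 'r) ring_scheme \<Rightarrow> ('a, 'e, 's) module_scheme \<Rightarrow> 'e set \<Rightarrow> 'a set \<Rightarrow> 'e set" where
  "module_colon R M L I = {z \<in> carrier M. \<forall>a\<in>I. a \<odot>\<^bsub>M\<^esub> z \<in> L}"

text \<open>\<open>(0 :\<^sub>M K)\<close> and \<open>(0 :\<^sub>R A)\<close>\<close>

abbreviation annihilated_by ::
  "('a, 'r) ring_scheme \<Rightarrow> ('a, 'e, 's) module_scheme \<Rightarrow> 'a set \<Rightarrow> 'e set" where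
  "annihilated_by R M K \<equiv> module_colon R M {\<zero>\<^bsub>M\<^esub>} K"

definition annihilator ::
  "('a, 'r) ring_scheme \<Rightarrow> ('a, 'e, 's) module_scheme \<Rightarrow> 'e set \<Rightarrow> 'a set" where
  "annihilator R M A = {a \<in> carrier R. \<forall>e\<in>A. a \<odot>\<^bsub>M\<^esub> e = \<zero>\<^bsub>M\<^esub>}"

definition submodule_generated ::
  "('a, 'r) ring_scheme \<Rightarrow> ('a, 'e, 's) module_scheme \<Rightarrow> 'e set \<Rightarrow> 'e set" where
  "submodule_generated R M S = \<Inter>{N. submodule N R M \<and> S \<subseteq> N}"

definition ideal_times_submodule ::
  "('a, 'r) ring_scheme \<Rightarrow> ('a, 'e, 's) module_scheme \<Rightarrow> 'a set \<Rightarrow> 'e set \<Rightarrow> 'e set" where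
  "ideal_times_submodule R M I L = submodule_generated R M {a \<odot>\<^bsub>M\<^esub> z | a z. a \<in> I \<and> z \<in> L}"

definition basically_full_closure ::
  "('a, 'r) ring_scheme \<Rightarrow> ('a, 'e, 's) module_scheme \<Rightarrow> 'a set \<Rightarrow> 'e set \<Rightarrow> 'e set" where
  "basically_full_closure R M I L = module_colon R M (ideal_times_submodule R M I L) I"


section \<open>Integral interior and integral hull\<close>

text \<open>Under Matlis duality over a complete local ring, with \<open>E\<close> the injective hull of the residue
  field, \<open>Hom(E, E) = R\<close>, \<open>Hom(E/A, E)\<close> is the ideal \<open>(0 :\<^sub>R A)\<close> and the dual of
  \<open>R/K\<close> is \<open>(0 :\<^sub>E K)\<close>; the dual of integral closure is written with these
  identifications.\<close>

definition integral_interior ::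
  "('a, 'r) ring_scheme \<Rightarrow> ('a, 'e, 's) module_scheme \<Rightarrow> 'e set \<Rightarrow> 'e set" where
  "integral_interior R E A = annihilated_by R E (integral_closure R (annihilator R E A))"

text \<open>The sum of a family of submodules is the submodule generated by its union.\<close>

definition integral_hull ::
  "('a, 'r) ring_scheme \<Rightarrow> ('a, 'e, 's) module_scheme \<Rightarrow> 'e set \<Rightarrow> 'e set" where
  "integral_hull R E A = submodule_generated R E
     (\<Union>{C. submodule C R E \<and> A \<subseteq> C \<and> integral_interior R E C = integral_interior R E A})"

end

theory Submission
  imports Defs
begin

text \<open>Both sides of the theorem are the submodule \<open>(0 :\<^sub>E core(I))\<close>. This comes from Matlis
  duality in the following form: \<open>K \<mapsto> (0 :\<^sub>E K)\<close> and \<open>A \<mapsto> (0 :\<^sub>R A)\<close> are mutually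
  inverse, order reversing bijections between the ideals of \<open>R\<close> and the submodules of \<open>E\<close>
  (\<open>ann_perp\<close>, \<open>perp_ann\<close>).

  On the left, a submodule \<open>C\<close> containing \<open>(0 :\<^sub>E I)\<close> has the integral interior of \<open>(0 :\<^sub>E I)\<close> if
  and only if the ideal \<open>(0 :\<^sub>R C) \<subseteq> I\<close> has the integral closure of \<open>I\<close>, and such ideals are the
  reductions of \<open>I\<close> (\<open>reduction_iff_integral_closure_eq\<close>). The sum of these \<open>C\<close> is dual to the
  intersection of the reductions, which is the core (\<open>integral_hull_perp\<close>). On the right, multiplying a
  submodule by \<open>I\<close> is dual to taking the quotient \<open>K : I\<close>, and vice versa, so that
  \<open>(I (0 :\<^sub>E K) :\<^sub>E I) = (0 :\<^sub>E I (K : I))\<close> (\<open>basically_full_closure_perp\<close>). For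
  \<open>K = J\<^sup>n : I\<^bsup>n-1\<^esup>\<close> and \<open>n \<ge> 1\<close> the quotient \<open>K : I\<close> is \<open>J\<^sup>n : I\<^sup>n\<close>, and by
  assumption \<open>I (J\<^sup>n : I\<^sup>n)\<close> is the core.

  The relation between reductions and integral closure rests on two facts. If \<open>x\<close> is integral over
  \<open>J\<close>, then \<open>J\<close> is a reduction of \<open>J + Rx\<close> (\<open>reduction_adjoin\<close>). Conversely every element of an
  ideal of which \<open>J\<close> is a reduction is integral over \<open>J\<close> (\<open>reduction_imp_integral\<close>); this is the
  determinant trick, done here by elimination. Since being a reduction is transitive, these give everything
  else, including that the integral closure is an ideal.

  In the duality, \<open>(0 :\<^sub>R (0 :\<^sub>E K)) = K\<close> follows from Baer's criterion applied to ideals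
  \<open>K + Ra\<close>. The equation \<open>(0 :\<^sub>E (0 :\<^sub>R C)) = C\<close> is first proved for submodules killed by a power
  of \<open>m\<close>, which are built up from simple modules (\<open>m_torsion_submodule_closed\<close>). Every element of
  \<open>E\<close> is killed by a power of \<open>m\<close> (\<open>m_power_torsion\<close>), and completeness of \<open>R\<close> extends the
  equation to all submodules.\<close>


section \<open>Products and powers of ideals\<close>

context cring
begin

lemma ideals_set_one [simp]: "\<one>\<^bsub>ideals_set R\<^esub> = carrier R"
  and ideals_set_mult [simp]: "I \<otimes>\<^bsub>ideals_set R\<^esub> J = I \<cdot> J"
  by (simp_all add: ideals_set_def)

lemma ideal_power_0: "ideal_power R I 0 = carrier R"
  by simp

lemma ideal_power_Suc: "ideal_power R I (Suc n) = ideal_power R I n \<cdot> I"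
  by simp

lemma one_ideal_prod: "ideal I R \<Longrightarrow> carrier R \<cdot> I = I"
  using ideal_prod_commute[OF oneideal] ideal_prod_one by simp

lemma ideal_power_ideal: "ideal I R \<Longrightarrow> ideal (ideal_power R I n) R"
  by (induction n) (simp_all add: ideal_power_Suc ideal_prod_is_ideal oneideal)

lemma ideal_power_add:
  assumes "ideal I R"
  shows "ideal_power R I (i + j) = ideal_power R I i \<cdot> ideal_power R I j"
proof (induction j)
  case 0
  show ?case by (simp add: ideal_prod_one ideal_power_ideal assms)
next
  case (Suc j)
  then show ?case
    by (simp add: ideal_power_Suc ideal_prod_assoc ideal_power_ideal assms)
qed

lemma ideal_power_1: "ideal I R \<Longrightarrow> ideal_power R I (Suc 0) = I"
  by (simp add: ideal_power_Suc one_ideal_prod)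

lemma element_pow_in_ideal_power:
  "ideal I R \<Longrightarrow> x \<in> I \<Longrightarrow> x [^] n \<in> ideal_power R I n"
  by (induction n) (auto simp: ideal_power_Suc intro: ideal_prod.prod)

lemma ideal_prod_mono:
  assumes "I \<subseteq> I'" "J \<subseteq> J'"
  shows "I \<cdot> J \<subseteq> I' \<cdot> J'"
proof
  fix z assume "z \<in> I \<cdot> J"
  then show "z \<in> I' \<cdot> J'"
    by induction (use assms in \<open>auto intro: ideal_prod.intros\<close>)
qed

lemma ideal_prod_least:
  assumes "ideal K R" "\<And>i j. i \<in> I \<Longrightarrow> j \<in> J \<Longrightarrow> i \<otimes> j \<in> K"
  shows "I \<cdot> J \<subseteq> K"
proof
  fix z assume "z \<in> I \<cdot> J"
  then show "z \<in> K"
    by induction (use assms in \<open>auto intro: additive_subgroup.a_closed[OF ideal.axioms(1)]\<close>)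
qed

lemma ideal_power_mono: "I \<subseteq> J \<Longrightarrow> ideal_power R I n \<subseteq> ideal_power R J n"
  by (induction n) (simp_all add: ideal_power_Suc ideal_prod_mono)

lemma ideal_power_decreasing:
  assumes "ideal I R" "i \<le> j"
  shows "ideal_power R I j \<subseteq> ideal_power R I i"
proof -
  obtain k where k: "j = i + k" using assms(2) le_Suc_ex by blast
  show ?thesis
    unfolding k ideal_power_add[OF assms(1)]
    using ideal_prod_inter[OF ideal_power_ideal ideal_power_ideal] assms(1) by blast
qed

lemma ideal_add_closed: "ideal K R \<Longrightarrow> a \<in> K \<Longrightarrow> b \<in> K \<Longrightarrow> a \<oplus> b \<in> K"
  by (simp add: additive_subgroup.a_closed ideal.axioms(1))

lemma ideal_sum_iff: "z \<in> A <+> B \<longleftrightarrow> (\<exists>a\<in>A. \<exists>b\<in>B. z = a \<oplus> b)"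
  by (auto simp: set_add_def')

lemma ideal_sum_upper1: "ideal A R \<Longrightarrow> ideal B R \<Longrightarrow> A \<subseteq> A <+> B"
  by (metis ideal_sum_iff additive_subgroup.zero_closed ideal.Icarr ideal.axioms(1) r_zero subsetI)

lemma ideal_sum_upper2: "ideal A R \<Longrightarrow> ideal B R \<Longrightarrow> B \<subseteq> A <+> B"
  by (metis ideal_sum_iff additive_subgroup.zero_closed ideal.Icarr ideal.axioms(1) l_zero subsetI)

lemma ideal_sum_least: "ideal K R \<Longrightarrow> A \<subseteq> K \<Longrightarrow> B \<subseteq> K \<Longrightarrow> A <+> B \<subseteq> K"
  by (auto simp: ideal_sum_iff intro!: ideal_add_closed)

lemma ideal_finsum_closed:
  assumes "ideal K R" "finite S" "\<And>i. i \<in> S \<Longrightarrow> f i \<in> K"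
  shows "(\<Oplus>i\<in>S. f i) \<in> K"
  using assms(2,3)
proof (induction S)
  case empty
  then show ?case
    by (simp add: additive_subgroup.zero_closed assms(1) ideal.axioms(1))
next
  case (insert i S)
  then have "f \<in> insert i S \<rightarrow> carrier R"
    using ideal.Icarr[OF assms(1)] by blast
  with insert show ?case
    by (simp add: additive_subgroup.a_closed assms(1) ideal.axioms(1))
qed

lemma PIdl_prod_iff:
  assumes "x \<in> carrier R" "ideal K R"
  shows "z \<in> (PIdl x) \<cdot> K \<longleftrightarrow> (\<exists>w\<in>K. z = x \<otimes> w)"
proof
  interpret K: ideal K R by fact
  assume "z \<in> (PIdl x) \<cdot> K"
  then show "\<exists>w\<in>K. z = x \<otimes> w"
  proof induction
    case (prod i j)
    then obtain a where "a \<in> carrier R" "i = a \<otimes> x" by (auto simp: cgenideal_def)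
    with prod assms have "i \<otimes> j = x \<otimes> (a \<otimes> j)" "a \<otimes> j \<in> K"
      by (simp_all add: K.I_l_closed m_ac K.Icarr)
    then show ?case by blast
  next
    case (sum s t)
    then show ?case
      by (metis K.Icarr K.a_closed assms(1) r_distr)
  qed
next
  assume "\<exists>w\<in>K. z = x \<otimes> w"
  then show "z \<in> (PIdl x) \<cdot> K"
    using cgenideal_self[OF assms(1)] by (auto intro: ideal_prod.prod)
qed

lemma Idl_insert_eq_sum:
  assumes "Y \<subseteq> carrier R" "y \<in> carrier R"
  shows "Idl (insert y Y) = PIdl y <+> Idl Y"
proof
  have I: "ideal (PIdl y) R" "ideal (Idl Y) R"
    using assms by (simp_all add: cgenideal_ideal genideal_ideal)
  show "Idl (insert y Y) \<subseteq> PIdl y <+> Idl Y"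
    using ideal_sum_upper1[OF I] ideal_sum_upper2[OF I] cgenideal_self[OF assms(2)]
      genideal_self[OF assms(1)]
    by (intro genideal_minimal add_ideals I) auto
  have J: "ideal (Idl (insert y Y)) R" "insert y Y \<subseteq> Idl (insert y Y)"
    using genideal_ideal[of "insert y Y"] genideal_self[of "insert y Y"] assms by simp_all
  then show "PIdl y <+> Idl Y \<subseteq> Idl (insert y Y)"
    by (intro ideal_sum_least genideal_minimal cgenideal_minimal) auto
qed

end


section \<open>Ideal quotients\<close>

context cring
begin

lemma ideal_colon_ideal:
  assumes A: "ideal A R" and B: "B \<subseteq> carrier R"
  shows "ideal (ideal_colon R A B) R"
proof (intro idealI ring_axioms add.subgroupI)
  fix a x assume a: "a \<in> ideal_colon R A B" and x: "x \<in> carrier R"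
  have "b \<otimes> (x \<otimes> a) \<in> A" if b: "b \<in> B" for b
  proof -
    have "b \<otimes> (x \<otimes> a) = x \<otimes> (b \<otimes> a)" using a b x B by (intro m_lcomm) (auto simp: ideal_colon_def)
    then show ?thesis using a b x ideal.I_l_closed[OF A] by (auto simp: ideal_colon_def)
  qed
  then show "x \<otimes> a \<in> ideal_colon R A B" "a \<otimes> x \<in> ideal_colon R A B"
    using a x by (auto simp: ideal_colon_def m_comm[of a x])
next
  note zA = additive_subgroup.zero_closed[OF ideal.axioms(1)[OF A]]
    and iA = additive_subgroup.a_inv_closed[OF ideal.axioms(1)[OF A]]
  have "\<zero> \<in> ideal_colon R A B" using B zA by (auto simp: ideal_colon_def subset_eq)
  then show "ideal_colon R A B \<noteq> {}" by blast
  show "\<ominus> a \<in> ideal_colon R A B" if "a \<in> ideal_colon R A B" for a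
    using that B iA by (auto simp: ideal_colon_def subset_eq r_minus)
  show "a \<oplus> b \<in> ideal_colon R A B" if "a \<in> ideal_colon R A B" "b \<in> ideal_colon R A B" for a b
    using that B ideal_add_closed[OF A] by (auto simp: ideal_colon_def subset_eq r_distr)
qed (auto simp: ideal_colon_def)

lemma ideal_colon_colon:
  assumes A: "ideal A R" and B: "ideal B R" and I: "ideal I R"
  shows "ideal_colon R (ideal_colon R A B) I = ideal_colon R A (B \<cdot> I)"
proof (intro equalityI subsetI)
  note Bc = ideal.Icarr[OF B] and Ic = ideal.Icarr[OF I]
  fix x assume x: "x \<in> ideal_colon R (ideal_colon R A B) I"
  have xc: "x \<in> carrier R" using x by (simp add: ideal_colon_def)
  have "B \<cdot> I \<subseteq> ideal_colon R A {x}"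
  proof (rule ideal_prod_least[OF ideal_colon_ideal[OF A]])
    fix b i assume b: "b \<in> B" and i: "i \<in> I"
    then have "b \<otimes> (i \<otimes> x) \<in> A" using x by (simp add: ideal_colon_def)
    moreover have "b \<otimes> (i \<otimes> x) = x \<otimes> (b \<otimes> i)" using Bc[OF b] Ic[OF i] xc by (simp add: m_ac)
    ultimately show "b \<otimes> i \<in> ideal_colon R A {x}" using Bc[OF b] Ic[OF i] by (simp add: ideal_colon_def)
  qed (use xc in auto)
  then show "x \<in> ideal_colon R A (B \<cdot> I)"
    using xc by (auto simp: ideal_colon_def subset_eq m_comm)
next
  note Bc = ideal.Icarr[OF B] and Ic = ideal.Icarr[OF I]
  fix x assume x: "x \<in> ideal_colon R A (B \<cdot> I)"
  have xc: "x \<in> carrier R" using x by (simp add: ideal_colon_def)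
  have "b \<otimes> (i \<otimes> x) \<in> A" if b: "b \<in> B" and i: "i \<in> I" for b i
  proof -
    have "(b \<otimes> i) \<otimes> x \<in> A"
      using x ideal_prod.prod[OF b i, of R] unfolding ideal_colon_def by blast
    then show ?thesis using Bc[OF b] Ic[OF i] xc by (simp add: m_assoc)
  qed
  then show "x \<in> ideal_colon R (ideal_colon R A B) I"
    using xc Ic by (simp add: ideal_colon_def)
qed

end


section \<open>Integral closure and reductions\<close>

context cring
begin

definition adjoin :: "'a set \<Rightarrow> 'a \<Rightarrow> 'a set" where
  "adjoin J x = J <+> PIdl x"

lemma
  assumes "ideal J R" "x \<in> carrier R"
  shows adjoin_ideal: "ideal (adjoin J x) R"
    and adjoin_upper: "J \<subseteq> adjoin J x"
    and adjoin_self: "x \<in> adjoin J x"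
proof -
  have P: "ideal (PIdl x) R" by (simp add: assms cgenideal_ideal)
  show "ideal (adjoin J x) R" "J \<subseteq> adjoin J x" "x \<in> adjoin J x"
    using add_ideals[OF assms(1) P] ideal_sum_upper1[OF assms(1) P] ideal_sum_upper2[OF assms(1) P]
      cgenideal_self[OF assms(2)] by (auto simp: adjoin_def)
qed

lemma adjoin_least:
  "ideal K R \<Longrightarrow> J \<subseteq> K \<Longrightarrow> x \<in> K \<Longrightarrow> adjoin J x \<subseteq> K"
  by (simp add: adjoin_def ideal_sum_least cgenideal_minimal)

text \<open>Write \<open>L = J + Rx\<close>. The ideal \<open>J L\<^sup>d\<close> consists of the sums of the terms
  \<open>a\<^sub>i x\<^bsup>d+1-i\<^esup>\<close> with \<open>a\<^sub>i \<in> J\<^sup>i\<close> and \<open>1 \<le> i \<le> d + 1\<close>, that is, of everything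
  below the leading term in an equation of integral dependence of degree \<open>d + 1\<close>. Working with
  this ideal turns statements about equations into statements about products of ideals.\<close>

definition lower_terms :: "'a set \<Rightarrow> 'a \<Rightarrow> nat \<Rightarrow> 'a set" where
  "lower_terms J x d = J \<cdot> ideal_power R (adjoin J x) d"

lemma lower_terms_ideal: "ideal J R \<Longrightarrow> x \<in> carrier R \<Longrightarrow> ideal (lower_terms J x d) R"
  by (simp add: lower_terms_def adjoin_ideal ideal_power_ideal ideal_prod_is_ideal)

lemma lower_terms_prod_power:
  assumes "ideal J R" "x \<in> carrier R"
  shows "lower_terms J x d \<cdot> ideal_power R (adjoin J x) e = lower_terms J x (d + e)"
  by (simp add: lower_terms_def ideal_power_add adjoin_ideal ideal_power_ideal ideal_prod_assoc assms)

lemma lower_terms_mult_pow: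
  assumes "ideal J R" "x \<in> carrier R" "q \<in> lower_terms J x d"
  shows "q \<otimes> x [^] e \<in> lower_terms J x (d + e)"
  using lower_terms_prod_power[OF assms(1,2), of d e] assms
  by (auto intro!: ideal_prod.prod[of q _ "x [^] e"] element_pow_in_ideal_power adjoin_ideal adjoin_self)

lemma lower_terms_prod_lower_terms:
  assumes "ideal J R" "x \<in> carrier R"
  shows "lower_terms J x d \<cdot> lower_terms J x e \<subseteq> lower_terms J x (Suc (d + e))"
proof -
  have *: "ideal (adjoin J x) R" "J \<subseteq> adjoin J x" using adjoin_ideal adjoin_upper assms by auto
  have "lower_terms J x e \<subseteq> ideal_power R (adjoin J x) (Suc e)"
    unfolding lower_terms_def ideal_power_Suc ideal_prod_commute[OF ideal_power_ideal[OF *(1)] *(1)]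
    by (rule ideal_prod_mono[OF *(2) order_refl])
  then have "lower_terms J x d \<cdot> lower_terms J x e \<subseteq> lower_terms J x d \<cdot> ideal_power R (adjoin J x) (Suc e)"
    by (rule ideal_prod_mono[OF order_refl])
  then show ?thesis
    unfolding lower_terms_prod_power[OF assms] by simp
qed

text \<open>Multiplying \<open>J L\<^sup>d\<close> by \<open>L = J + Rx\<close> gives \<open>J L\<^sup>d \<cdot> J + x J L\<^sup>d\<close>. Part of
  the first summand is again divisible by \<open>x\<close>, and the induction removes that part until only
  \<open>J\<^bsup>d+2\<^esup>\<close> is left. This splits off the constant coefficient of a polynomial expression in \<open>x\<close>.\<close>

lemma lower_terms_Suc_decompose:
  assumes J: "ideal J R" and x: "x \<in> carrier R" and z: "z \<in> lower_terms J x (Suc d)"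
  shows "\<exists>b\<in>ideal_power R J (Suc (Suc d)). \<exists>w\<in>lower_terms J x d. z = b \<oplus> x \<otimes> w"
proof -
  let ?L = "ideal_power R (adjoin J x)" and ?J = "ideal_power R J"
  have iJ: "ideal (?J k) R" and iP: "ideal (PIdl x) R" and iL: "ideal (?L k) R"
    and iT: "ideal (lower_terms J x k) R" and iA: "ideal (adjoin J x) R" for k
    using assms by (simp_all add: ideal_power_ideal cgenideal_ideal adjoin_ideal lower_terms_ideal)
  have T: "lower_terms J x (Suc k) = lower_terms J x k \<cdot> J <+> (PIdl x) \<cdot> lower_terms J x k" for k
    using lower_terms_prod_power[OF J x, of k 1] iP iT J iA
    by (simp add: one_ideal_prod adjoin_def ideal_prod_distr(1) ideal_prod_commute[OF iP iT])
  have "lower_terms J x (Suc d) \<subseteq> ?J (Suc (Suc d)) <+> (PIdl x) \<cdot> lower_terms J x d"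
  proof (induction d)
    case 0
    show ?case
      unfolding T by (simp add: lower_terms_def ideal_power_Suc ideal_prod_one J one_ideal_prod)
  next
    case (Suc d)
    let ?K = "?J (Suc (Suc (Suc d))) <+> (PIdl x) \<cdot> lower_terms J x (Suc d) :: 'a set"
    have iK: "ideal ?K R" and iPT: "ideal ((PIdl x) \<cdot> lower_terms J x k) R" for k
      by (intro add_ideals ideal_prod_is_ideal iJ iP iT)+
    have "lower_terms J x (Suc d) \<cdot> J \<subseteq> (?J (Suc (Suc d)) <+> (PIdl x) \<cdot> lower_terms J x d) \<cdot> J"
      by (rule ideal_prod_mono[OF Suc order_refl])
    also have "\<dots> = ?J (Suc (Suc (Suc d))) <+> (PIdl x) \<cdot> (lower_terms J x d \<cdot> J)"
      unfolding ideal_prod_distr(2)[OF J iJ iPT] ideal_power_Suc[of J "Suc (Suc d)"]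
        ideal_prod_assoc[OF iP iT J] ..
    also have "\<dots> \<subseteq> ?K"
    proof (intro ideal_sum_least iK)
      show "?J (Suc (Suc (Suc d))) \<subseteq> ?K" by (rule ideal_sum_upper1[OF iJ iPT])
      have "lower_terms J x d \<cdot> J \<subseteq> lower_terms J x d \<cdot> ?L (Suc 0)"
        unfolding ideal_power_1[OF iA] by (rule ideal_prod_mono[OF order_refl adjoin_upper[OF J x]])
      then have "(PIdl x) \<cdot> (lower_terms J x d \<cdot> J) \<subseteq> (PIdl x) \<cdot> lower_terms J x (Suc d)"
        unfolding lower_terms_prod_power[OF J x] by (simp add: ideal_prod_mono)
      also have "\<dots> \<subseteq> ?K" by (rule ideal_sum_upper2[OF iJ iPT])
      finally show "(PIdl x) \<cdot> (lower_terms J x d \<cdot> J) \<subseteq> ?K" .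
    qed
    finally have "lower_terms J x (Suc d) \<cdot> J \<subseteq> ?K" .
    moreover have "(PIdl x) \<cdot> lower_terms J x (Suc d) \<subseteq> ?K"
      by (rule ideal_sum_upper2[OF iJ iPT])
    ultimately show ?case
      unfolding T[of "Suc d"] by (intro ideal_sum_least iK)
  qed
  from subsetD[OF this z] obtain b p where
    "b \<in> ?J (Suc (Suc d))" "p \<in> (PIdl x) \<cdot> lower_terms J x d" "z = b \<oplus> p"
    unfolding ideal_sum_iff by blast
  then show ?thesis
    unfolding PIdl_prod_iff[OF x iT] by auto
qed

lemma lower_terms_expand:
  assumes J: "ideal J R" and x: "x \<in> carrier R" and z: "z \<in> lower_terms J x d"
  shows "\<exists>a. (\<forall>i\<in>{1..Suc d}. a i \<in> ideal_power R J i) \<and>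
    z = (\<Oplus>i\<in>{1..Suc d}. a i \<otimes> x [^] (Suc d - i))"
  using z
proof (induction d arbitrary: z)
  case 0
  then have "z \<in> J" by (simp add: lower_terms_def ideal_prod_one J)
  moreover from this have "z \<in> carrier R" by (rule ideal.Icarr[OF J])
  ultimately show ?case
    by (intro exI[of _ "\<lambda>_. z"]) (simp add: one_ideal_prod J)
next
  case (Suc d)
  obtain b w where bw: "b \<in> ideal_power R J (Suc (Suc d))" "w \<in> lower_terms J x d" "z = b \<oplus> x \<otimes> w"
    using lower_terms_Suc_decompose[OF J x Suc.prems] by blast
  obtain a where a: "\<forall>i\<in>{1..Suc d}. a i \<in> ideal_power R J i"
    and w: "w = (\<Oplus>i\<in>{1..Suc d}. a i \<otimes> x [^] (Suc d - i))"
    using Suc.IH[OF bw(2)] by blast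
  have carr: "a i \<in> carrier R" if "i \<in> {1..Suc d}" for i
    using a that ideal.Icarr[OF ideal_power_ideal[OF J]] by blast
  have b: "b \<in> carrier R" using bw(1) ideal.Icarr[OF ideal_power_ideal[OF J]] by blast
  let ?a = "a(Suc (Suc d) := b)"
  have "x \<otimes> w = (\<Oplus>i\<in>{1..Suc d}. x \<otimes> (a i \<otimes> x [^] (Suc d - i)))"
    unfolding w using carr x by (intro finsum_rdistr) auto
  also have "\<dots> = (\<Oplus>i\<in>{1..Suc d}. ?a i \<otimes> x [^] (Suc (Suc d) - i))"
  proof (rule finsum_cong')
    fix i assume i: "i \<in> {1..Suc d}"
    then have "Suc (Suc d) - i = Suc (Suc d - i)" by auto
    with i carr[OF i] x show "x \<otimes> (a i \<otimes> x [^] (Suc d - i)) = ?a i \<otimes> x [^] (Suc (Suc d) - i)"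
      by (simp add: m_ac)
  qed (use carr x in auto)
  finally have xw: "x \<otimes> w = (\<Oplus>i\<in>{1..Suc d}. ?a i \<otimes> x [^] (Suc (Suc d) - i))" .
  have "{1..Suc (Suc d)} = insert (Suc (Suc d)) {1..Suc d}" by auto
  then have "(\<Oplus>i\<in>{1..Suc (Suc d)}. ?a i \<otimes> x [^] (Suc (Suc d) - i)) = b \<oplus> x \<otimes> w"
    unfolding xw using carr x b by (subst \<open>{1..Suc (Suc d)} = _\<close>, subst finsum_insert) auto
  with a bw show ?case by (intro exI[of _ ?a]) (auto simp: le_Suc_eq)
qed

text \<open>This frees the arguments below from the coefficients of an equation of integral dependence.\<close>

lemma integral_closure_iff:
  assumes J: "ideal J R" and x: "x \<in> carrier R"
  shows "x \<in> integral_closure R J \<longleftrightarrow> (\<exists>d. x [^] Suc d \<in> lower_terms J x d)"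
proof
  let ?L = "ideal_power R (adjoin J x)"
  have iA: "ideal (adjoin J x) R" "J \<subseteq> adjoin J x" "x \<in> adjoin J x"
    using adjoin_ideal adjoin_upper adjoin_self assms by auto
  assume "x \<in> integral_closure R J"
  then obtain n a where n: "1 \<le> n" and a: "\<And>i. i \<in> {1..n} \<Longrightarrow> a i \<in> ideal_power R J i"
    and eq: "x [^] n \<oplus> (\<Oplus>i\<in>{1..n}. a i \<otimes> x [^] (n - i)) = \<zero>"
    unfolding integral_closure_def by blast
  have T: "ideal (lower_terms J x (n - 1)) R" by (rule lower_terms_ideal[OF assms])
  have s: "(\<Oplus>i\<in>{1..n}. a i \<otimes> x [^] (n - i)) \<in> lower_terms J x (n - 1)"
  proof (rule ideal_finsum_closed[OF T])
    fix i assume i: "i \<in> {1..n}"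
    then obtain j where j: "i = Suc j" by (cases i) auto
    have "ideal_power R J i = J \<cdot> ideal_power R J j"
      by (simp add: j ideal_power_Suc ideal_prod_commute J ideal_power_ideal)
    also have "\<dots> \<subseteq> lower_terms J x j"
      unfolding lower_terms_def by (intro ideal_prod_mono ideal_power_mono iA order_refl)
    finally have "a i \<otimes> x [^] (n - i) \<in> lower_terms J x (j + (n - i))"
      using a[OF i] lower_terms_mult_pow[OF assms] by blast
    then show "a i \<otimes> x [^] (n - i) \<in> lower_terms J x (n - 1)"
      using i j by simp
  qed auto
  have "x [^] n = \<ominus> (\<Oplus>i\<in>{1..n}. a i \<otimes> x [^] (n - i))"
    using eq s ideal.Icarr[OF T] x by (intro minus_equality[symmetric]) auto
  also have "\<dots> \<in> lower_terms J x (n - 1)"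
    using s T by (simp add: additive_subgroup.a_inv_closed ideal.axioms(1))
  finally have "x [^] n \<in> lower_terms J x (n - 1)" .
  moreover obtain d where "n = Suc d" using n by (cases n) auto
  ultimately show "\<exists>d. x [^] Suc d \<in> lower_terms J x d"
    by (intro exI[of _ d]) simp
next
  assume "\<exists>d. x [^] Suc d \<in> lower_terms J x d"
  then obtain d where d: "x [^] Suc d \<in> lower_terms J x d" by blast
  have T: "ideal (lower_terms J x d) R" by (rule lower_terms_ideal[OF assms])
  have "\<ominus> (x [^] Suc d) \<in> lower_terms J x d"
    using d T by (simp add: additive_subgroup.a_inv_closed ideal.axioms(1))
  from lower_terms_expand[OF assms this] obtain a where
    a: "\<forall>i\<in>{1..Suc d}. a i \<in> ideal_power R J i"
    and eq: "\<ominus> (x [^] Suc d) = (\<Oplus>i\<in>{1..Suc d}. a i \<otimes> x [^] (Suc d - i))"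
    by blast
  have "x [^] Suc d \<oplus> (\<Oplus>i\<in>{1..Suc d}. a i \<otimes> x [^] (Suc d - i)) = \<zero>"
    unfolding eq[symmetric] using x by (intro r_neg) auto
  with a x show "x \<in> integral_closure R J"
    unfolding integral_closure_def by (intro CollectI conjI exI[of _ "Suc d"] exI[of _ a]) auto
qed

lemma reductionI:
  assumes "ideal J R" "ideal I R" "J \<subseteq> I" "ideal_power R I (Suc s) \<subseteq> J \<cdot> ideal_power R I s"
  shows "reduction R J I"
proof -
  have "J \<cdot> ideal_power R I s \<subseteq> I \<cdot> ideal_power R I s"
    by (rule ideal_prod_mono[OF assms(3) order_refl])
  also have "\<dots> = ideal_power R I (Suc s)"
    unfolding ideal_power_Suc by (rule ideal_prod_commute[OF assms(2) ideal_power_ideal[OF assms(2)]])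
  finally show ?thesis
    using assms unfolding reduction_def by blast
qed

lemma reduction_refl: "ideal I R \<Longrightarrow> reduction R I I"
  by (rule reductionI[of I I 0]) (simp_all add: one_ideal_prod ideal_prod_one)

text \<open>If \<open>B\<^bsup>s+1\<^esup> = J B\<^sup>s\<close> and \<open>L\<^bsup>t+1\<^esup> = B L\<^sup>t\<close>, then
  \<open>L\<^bsup>s+t+1\<^esup> = B\<^bsup>s+1\<^esup> L\<^sup>t = J B\<^sup>s L\<^sup>t = J L\<^bsup>s+t\<^esup>\<close>.\<close>

lemma reduction_trans:
  assumes JB: "reduction R J B" and BL: "reduction R B L" and L: "ideal L R"
  shows "reduction R J L"
proof -
  have J: "ideal J R" "J \<subseteq> B" and B: "ideal B R" "B \<subseteq> L"
    using JB BL by (auto simp: reduction_def)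
  obtain s where s: "ideal_power R B (Suc s) = J \<cdot> ideal_power R B s"
    using JB by (auto simp: reduction_def)
  obtain t where t: "ideal_power R L (Suc t) = B \<cdot> ideal_power R L t"
    using BL by (auto simp: reduction_def)
  note iB = ideal_power_ideal[OF B(1)] and iL = ideal_power_ideal[OF L]
  have pow: "ideal_power R L (k + t) = ideal_power R B k \<cdot> ideal_power R L t" for k
  proof (induction k)
    case 0
    show ?case by (simp add: one_ideal_prod iL)
  next
    case (Suc k)
    have "ideal_power R L (Suc k + t) = (ideal_power R B k \<cdot> ideal_power R L t) \<cdot> L"
      using Suc by simp
    also have "\<dots> = ideal_power R B k \<cdot> (B \<cdot> ideal_power R L t)"
      using t by (simp add: ideal_prod_assoc iB iL L)
    also have "\<dots> = ideal_power R B (Suc k) \<cdot> ideal_power R L t"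
      by (simp add: ideal_prod_assoc iB iL B)
    finally show ?case .
  qed
  have "ideal_power R L (Suc (s + t)) = ideal_power R B (Suc s) \<cdot> ideal_power R L t"
    using pow[of "Suc s"] by simp
  also have "\<dots> = J \<cdot> (ideal_power R B s \<cdot> ideal_power R L t)"
    unfolding s by (rule ideal_prod_assoc[OF J(1) iB iL])
  also have "\<dots> = J \<cdot> ideal_power R L (s + t)"
    by (simp only: pow)
  finally show ?thesis
    using J B by (intro reductionI[of J L "s + t"] L) auto
qed

text \<open>Modulo \<open>J L\<^sup>k\<close>, the power \<open>L\<^bsup>k+1\<^esup>\<close> of \<open>L = J + Rx\<close> is generated by
  \<open>x\<^bsup>k+1\<^esup>\<close> alone. An equation of integral dependence of degree \<open>d + 1\<close> puts
  \<open>x\<^bsup>d+1\<^esup>\<close> into \<open>J L\<^sup>d\<close>, so that \<open>L\<^bsup>d+1\<^esup> = J L\<^sup>d\<close>.\<close>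

lemma reduction_adjoin:
  assumes J: "ideal J R" and x: "x \<in> integral_closure R J"
  shows "reduction R J (adjoin J x)"
proof -
  have xc: "x \<in> carrier R" using x by (simp add: integral_closure_def)
  obtain d where d: "x [^] Suc d \<in> lower_terms J x d"
    using x integral_closure_iff[OF J xc] by blast
  let ?A = "adjoin J x"
  have A: "ideal ?A R" "J \<subseteq> ?A" using adjoin_ideal adjoin_upper J xc by auto
  note iA = ideal_power_ideal[OF A(1)] and iT = lower_terms_ideal[OF J xc]
  have P: "ideal (PIdl (x [^] k)) R" for k :: nat using xc by (simp add: cgenideal_ideal)
  have step: "ideal_power R ?A (Suc k) \<subseteq> lower_terms J x k <+> PIdl (x [^] Suc k)" for k
  proof (induction k)
    case 0
    show ?case
      unfolding lower_terms_def ideal_power_1[OF A(1)] ideal_power_0 ideal_prod_one[OF J]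
      using xc by (simp add: adjoin_def)
  next
    case (Suc k)
    let ?K = "lower_terms J x (Suc k) <+> PIdl (x [^] Suc (Suc k)) :: 'a set"
    have K: "ideal ?K R" by (intro add_ideals iT P)
    note K1 = ideal_sum_upper1[OF iT[of "Suc k"] P[of "Suc (Suc k)"]]
      and K2 = ideal_sum_upper2[OF iT[of "Suc k"] P[of "Suc (Suc k)"]]
    have "z \<otimes> a \<in> ?K" if z: "z \<in> ideal_power R ?A (Suc k)" and a: "a \<in> ?A" for z a
    proof -
      obtain q r where q: "q \<in> lower_terms J x k" and r: "r \<in> carrier R" and zq: "z = q \<oplus> r \<otimes> x [^] Suc k"
        using subsetD[OF Suc z] unfolding ideal_sum_iff cgenideal_def by blast
      obtain j u where j: "j \<in> J" and u: "u \<in> carrier R" and aj: "a = j \<oplus> u \<otimes> x"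
        using a unfolding adjoin_def ideal_sum_iff cgenideal_def by blast
      have car: "q \<in> carrier R" "j \<in> carrier R" "a \<in> carrier R"
        by (rule ideal.Icarr[OF iT q] ideal.Icarr[OF J j] ideal.Icarr[OF A(1) a])+
      have qa: "q \<otimes> a \<in> lower_terms J x (Suc k)"
        using ideal_prod.prod[OF q a, of R] lower_terms_prod_power[OF J xc, of k "Suc 0"]
        unfolding ideal_power_1[OF A(1)] by simp
      have "j \<otimes> x [^] Suc k \<in> lower_terms J x (Suc k)"
        unfolding lower_terms_def using j xc
        by (intro ideal_prod.prod element_pow_in_ideal_power A adjoin_self J)
      then have rj: "r \<otimes> (j \<otimes> x [^] Suc k) \<in> lower_terms J x (Suc k)"
        by (rule ideal.I_l_closed[OF iT _ r])
      have ru: "(r \<otimes> u) \<otimes> x [^] Suc (Suc k) \<in> PIdl (x [^] Suc (Suc k))"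
        unfolding cgenideal_def using r u by blast
      have "(q \<oplus> r \<otimes> t) \<otimes> (j \<oplus> u \<otimes> x) =
          (q \<otimes> (j \<oplus> u \<otimes> x) \<oplus> r \<otimes> (j \<otimes> t)) \<oplus> (r \<otimes> u) \<otimes> (t \<otimes> x)" if "t \<in> carrier R" for t
        using r u car xc that by algebra
      from this[of "x [^] Suc k"]
      have "z \<otimes> a = (q \<otimes> a \<oplus> r \<otimes> (j \<otimes> x [^] Suc k)) \<oplus> (r \<otimes> u) \<otimes> x [^] Suc (Suc k)"
        using xc unfolding zq aj by simp
      also have "\<dots> \<in> ?K"
        using subsetD[OF K1 qa] subsetD[OF K1 rj] subsetD[OF K2 ru]
        by (intro ideal_add_closed[OF K])
      finally show ?thesis .
    qed
    then show ?case
      unfolding ideal_power_Suc[of ?A "Suc k"] by (rule ideal_prod_least[OF K])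
  qed
  have "lower_terms J x d <+> PIdl (x [^] Suc d) \<subseteq> lower_terms J x d"
    by (rule ideal_sum_least[OF iT order_refl cgenideal_minimal[OF iT d]])
  with step[of d] have "ideal_power R ?A (Suc d) \<subseteq> J \<cdot> ideal_power R ?A d"
    unfolding lower_terms_def by (rule order_trans)
  then show ?thesis
    by (rule reductionI[OF J A])
qed

lemma annihilates_Idl:
  assumes "p \<in> carrier R" "Y \<subseteq> carrier R" "\<And>y. y \<in> Y \<Longrightarrow> p \<otimes> y = \<zero>" "w \<in> Idl Y"
  shows "p \<otimes> w = \<zero>"
proof -
  have "ideal {w \<in> carrier R. p \<otimes> w = \<zero>} R"
  proof (intro idealI ring_axioms add.subgroupI)
    fix a x assume "a \<in> {w \<in> carrier R. p \<otimes> w = \<zero>}" "x \<in> carrier R"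
    then have "a \<in> carrier R" "x \<in> carrier R" "p \<otimes> a = \<zero>" by auto
    moreover from this have "p \<otimes> (x \<otimes> a) = x \<otimes> (p \<otimes> a)" "p \<otimes> (a \<otimes> x) = (p \<otimes> a) \<otimes> x"
      using assms(1) m_lcomm m_assoc by metis+
    ultimately show "x \<otimes> a \<in> {w \<in> carrier R. p \<otimes> w = \<zero>}" "a \<otimes> x \<in> {w \<in> carrier R. p \<otimes> w = \<zero>}"
      by auto
  qed (use assms(1) in \<open>auto simp: r_distr r_minus simp flip: a_inv_def intro: exI[of _ \<zero>]\<close>)
  moreover have "Y \<subseteq> {w \<in> carrier R. p \<otimes> w = \<zero>}" using assms by auto
  ultimately show ?thesis using genideal_minimal assms(4) by blast
qed

text \<open>This takes the place of the Cayley-Hamilton theorem. The hypothesis says that the elements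
  \<open>y\<close> of \<open>Y\<close> solve a square system of linear equations whose matrix has the form
  \<open>x\<^bsup>d+1\<^esup> \<cdot> 1 - Q\<close>, where the entries of \<open>Q\<close> lie in \<open>J L\<^sup>d\<close>. Call an element of
  \<open>x\<^bsup>d+1\<^esup> + J L\<^sup>d\<close> monic of degree \<open>d + 1\<close>. Products of monic elements are monic, and the
  entries of \<open>Q\<close> stay below the leading term when they are multiplied by monic elements. So the
  system can be solved by elimination without division: a monic \<open>b\<close> with
  \<open>b y\<^sub>0 \<in> J L\<^sup>d \<cdot> (Idl Y)\<close> is used to remove \<open>y\<^sub>0\<close> from the other equations, which
  leaves a system of the same form, of twice the degree, for the remaining elements. If \<open>p\<close>
  is monic and kills all of those, then \<open>p b\<close> is monic and also kills \<open>y\<^sub>0\<close>.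

  The statement avoids matrices by letting the ideal \<open>Idl Y\<close> absorb the coefficients, and the
  degree is the same for all elements of \<open>Y\<close>, which the doubling preserves.\<close>

lemma common_monic_annihilator:
  assumes J: "ideal J R" and x: "x \<in> carrier R"
    and "finite Y" "Y \<subseteq> carrier R" "\<And>y. y \<in> Y \<Longrightarrow> x [^] Suc d \<otimes> y \<in> lower_terms J x d \<cdot> (Idl Y)"
  shows "\<exists>e. \<exists>q\<in>lower_terms J x e. \<forall>y\<in>Y. (x [^] Suc e \<oplus> q) \<otimes> y = \<zero>"
  using assms(3-5)
proof (induction Y arbitrary: d rule: finite_induct)
  case empty
  then show ?case
    using additive_subgroup.zero_closed[OF ideal.axioms(1)[OF lower_terms_ideal[OF J x]]] by auto
next
  case (insert y0 Y)
  note iT = lower_terms_ideal[OF J x]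
  have Yc: "Y \<subseteq> carrier R" and y0: "y0 \<in> carrier R" using insert.prems by auto
  have iY: "ideal (Idl Y) R" and iy: "ideal (PIdl y0) R"
    using Yc y0 by (simp_all add: genideal_ideal cgenideal_ideal)
  note iTY = ideal_prod_is_ideal[OF iT iY]
  define xd where "xd = x [^] Suc d"
  have xd: "xd \<in> carrier R" using x by (simp add: xd_def)
  have split: "\<exists>q\<in>lower_terms J x d. \<exists>w\<in>lower_terms J x d \<cdot> (Idl Y). xd \<otimes> y = q \<otimes> y0 \<oplus> w"
    if "y \<in> insert y0 Y" for y
  proof -
    have "lower_terms J x d \<cdot> (Idl (insert y0 Y)) = (PIdl y0) \<cdot> lower_terms J x d <+> lower_terms J x d \<cdot> (Idl Y)"
      by (simp add: Idl_insert_eq_sum[OF Yc y0] ideal_prod_distr(1)[OF iT iy iY]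
          ideal_prod_commute[OF iT iy])
    with insert.prems(2)[OF that, folded xd_def] obtain p w where
      "p \<in> (PIdl y0) \<cdot> lower_terms J x d" "w \<in> lower_terms J x d \<cdot> (Idl Y)" "xd \<otimes> y = p \<oplus> w"
      by (auto simp: ideal_sum_iff)
    moreover from this(1) obtain q where "q \<in> lower_terms J x d" "p = y0 \<otimes> q"
      using PIdl_prod_iff[OF y0 iT] by blast
    ultimately show ?thesis
      using m_comm[OF y0 ideal.Icarr[OF iT]] by (metis (no_types))
  qed
  obtain q0 w0 where q0: "q0 \<in> lower_terms J x d" and w0: "w0 \<in> lower_terms J x d \<cdot> (Idl Y)"
    and eq0: "xd \<otimes> y0 = q0 \<otimes> y0 \<oplus> w0"
    using split[of y0] by blast
  \<comment> \<open>The monic coefficient of \<open>y0\<close> once its own lower order multiple is moved to the left.\<close>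
  define b where "b = xd \<ominus> q0"
  have car: "q0 \<in> carrier R" "w0 \<in> carrier R" "b \<in> carrier R"
    using ideal.Icarr[OF iT q0] ideal.Icarr[OF iTY w0] xd by (simp_all add: b_def)
  have by0: "b \<otimes> y0 = w0"
  proof -
    have "b \<otimes> y0 = xd \<otimes> y0 \<ominus> q0 \<otimes> y0"
      unfolding b_def using xd y0 car by algebra
    also have "\<dots> = w0"
      unfolding eq0 using xd y0 car by algebra
    finally show ?thesis .
  qed
  \<comment> \<open>Lower terms of index \<open>d\<close> have degree \<open>d + 1\<close>, so doubling the degree gives index \<open>2d + 1\<close>.\<close>
  let ?d = "Suc (d + d)"
  have TT: "lower_terms J x d \<cdot> lower_terms J x d \<subseteq> lower_terms J x ?d" by (rule lower_terms_prod_lower_terms[OF J x])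
  have TTY: "q \<otimes> w \<in> lower_terms J x ?d \<cdot> (Idl Y)" if q: "q \<in> lower_terms J x d" and w: "w \<in> lower_terms J x d \<cdot> (Idl Y)" for q w
  proof -
    have "q \<otimes> w \<in> lower_terms J x d \<cdot> (lower_terms J x d \<cdot> (Idl Y))" using q w by (rule ideal_prod.prod)
    also have "\<dots> = (lower_terms J x d \<cdot> lower_terms J x d) \<cdot> (Idl Y)" by (rule ideal_prod_assoc[symmetric, OF iT iT iY])
    also have "\<dots> \<subseteq> lower_terms J x ?d \<cdot> (Idl Y)" by (rule ideal_prod_mono[OF TT order_refl])
    finally show ?thesis .
  qed
  have xT: "xd \<otimes> w \<in> lower_terms J x ?d \<cdot> (Idl Y)" if w: "w \<in> lower_terms J x d \<cdot> (Idl Y)" for w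
  proof -
    have "xd \<otimes> w \<in> ideal_power R (adjoin J x) (Suc d) \<cdot> (lower_terms J x d \<cdot> (Idl Y))"
      unfolding xd_def using w x J by (intro ideal_prod.prod element_pow_in_ideal_power adjoin_ideal adjoin_self)
    also have "\<dots> = (lower_terms J x d \<cdot> ideal_power R (adjoin J x) (Suc d)) \<cdot> (Idl Y)"
      using ideal_power_ideal[OF adjoin_ideal[OF J x]]
      by (metis ideal_prod_assoc[OF _ iT iY] ideal_prod_commute[OF iT])
    also have "\<dots> = lower_terms J x ?d \<cdot> (Idl Y)"
      unfolding lower_terms_prod_power[OF J x] by simp
    finally show ?thesis .
  qed
  have "x [^] Suc ?d \<otimes> y \<in> lower_terms J x ?d \<cdot> (Idl Y)" if y: "y \<in> Y" for y
  proof -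
    obtain q w where q: "q \<in> lower_terms J x d" and w: "w \<in> lower_terms J x d \<cdot> (Idl Y)"
      and eq: "xd \<otimes> y = q \<otimes> y0 \<oplus> w"
      using split[of y] y by blast
    have c: "q \<in> carrier R" "w \<in> carrier R" "y \<in> carrier R"
      using ideal.Icarr[OF iT q] ideal.Icarr[OF iTY w] y Yc by auto
    have "x [^] Suc ?d = xd \<otimes> xd"
      using nat_pow_mult[OF x, of "Suc d" "Suc d"] by (simp add: xd_def)
    \<comment> \<open>Multiply the equation for \<open>y\<close> by \<open>b = xd - q0\<close>: in
        \<open>b \<otimes> (q \<otimes> y0)\<close> the product \<open>b \<otimes> y0 = w0\<close> involves \<open>Y\<close> only.\<close>
    then have "x [^] Suc ?d \<otimes> y = b \<otimes> (xd \<otimes> y) \<oplus> q0 \<otimes> (xd \<otimes> y)"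
      unfolding b_def using xd c car by algebra
    also have "b \<otimes> (xd \<otimes> y) = q \<otimes> (b \<otimes> y0) \<oplus> b \<otimes> w"
      unfolding eq using c car y0 by algebra
    also have "b \<otimes> w = xd \<otimes> w \<ominus> q0 \<otimes> w"
      unfolding b_def using xd c car by algebra
    finally have E: "x [^] Suc ?d \<otimes> y =
      (q \<otimes> w0 \<oplus> (xd \<otimes> w \<ominus> q0 \<otimes> w)) \<oplus> q0 \<otimes> (xd \<otimes> y)"
      unfolding by0 .
    have "q0 \<otimes> (xd \<otimes> y) \<in> lower_terms J x ?d \<cdot> (Idl Y)"
    proof -
      have "q0 \<otimes> xd \<in> lower_terms J x ?d"
        using lower_terms_mult_pow[OF J x q0, of "Suc d"] by (simp add: xd_def)
      moreover have "y \<in> Idl Y" using genideal_self[OF Yc] y by blast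
      ultimately have "(q0 \<otimes> xd) \<otimes> y \<in> lower_terms J x ?d \<cdot> (Idl Y)"
        by (rule ideal_prod.prod)
      then show ?thesis using car xd c by (simp add: m_assoc)
    qed
    moreover have "\<ominus> (q0 \<otimes> w) \<in> lower_terms J x ?d \<cdot> (Idl Y)"
      using TTY[OF q0 w] by (rule additive_subgroup.a_inv_closed[OF ideal.axioms(1)[OF iTY]])
    ultimately show ?thesis
      unfolding E a_minus_def using TTY[OF q w0] xT[OF w] by (intro ideal_add_closed[OF iTY])
  qed
  with insert.IH[OF Yc, of ?d]  obtain e q where q: "q \<in> lower_terms J x e"
    and kill: "\<forall>y\<in>Y. (x [^] Suc e \<oplus> q) \<otimes> y = \<zero>" by blast
  define xe where "xe = x [^] Suc e"
  have xe: "xe \<in> carrier R" using x by (simp add: xe_def)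
  note kill = kill[folded xe_def]
  define p where "p = xe \<oplus> q"
  have qc: "q \<in> carrier R" "p \<in> carrier R" using ideal.Icarr[OF iT q] xe by (simp_all add: p_def)
  have killY: "p \<otimes> w = \<zero>" if "w \<in> Idl Y" for w
    using annihilates_Idl[OF qc(2) Yc _ that] kill unfolding p_def by blast
  have w0Y: "w0 \<in> Idl Y" using ideal_prod_inter[OF iT iY] w0 by blast
  let ?e = "Suc (e + d)"
  \<comment> \<open>The lower order part of the product of \<open>p\<close> and \<open>b\<close>.\<close>
  define r where "r = q \<otimes> xd \<oplus> (\<ominus> (q0 \<otimes> xe) \<oplus> \<ominus> (q \<otimes> q0))"
  have r: "r \<in> lower_terms J x ?e"
    unfolding r_def
  proof (intro ideal_add_closed[OF iT] additive_subgroup.a_inv_closed[OF ideal.axioms(1)[OF iT]])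
    show "q \<otimes> xd \<in> lower_terms J x ?e" using lower_terms_mult_pow[OF J x q, of "Suc d"] by (simp add: xd_def)
    show "q0 \<otimes> xe \<in> lower_terms J x ?e"
      using lower_terms_mult_pow[OF J x q0, of "Suc e"] by (simp add: add.commute xe_def)
    show "q \<otimes> q0 \<in> lower_terms J x ?e"
      using ideal_prod.prod[OF q q0] lower_terms_prod_lower_terms[OF J x, of e d] by blast
  qed
  have "x [^] Suc ?e = xe \<otimes> xd"
    using nat_pow_mult[OF x, of "Suc e" "Suc d"] by (simp add: xd_def xe_def)
  then have pb: "x [^] Suc ?e \<oplus> r = p \<otimes> b"
    unfolding r_def p_def b_def using xd xe qc car by algebra
  have "(x [^] Suc ?e \<oplus> r) \<otimes> y = \<zero>" if "y \<in> insert y0 Y" for y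
  proof (cases "y = y0")
    case True
    then show ?thesis
      unfolding pb using killY[OF w0Y] by0 qc car y0 by (simp add: m_assoc)
  next
    case False
    with that have "y \<in> Y" by simp
    then have "p \<otimes> y = \<zero>" "y \<in> carrier R" using kill Yc by (auto simp: p_def)
    then show ?thesis
      unfolding pb using qc car by (simp add: m_assoc m_comm[of b])(simp add: m_assoc[symmetric])
  qed
  with r show ?case by blast
qed

lemma integral_closure_mono: "J \<subseteq> K \<Longrightarrow> integral_closure R J \<subseteq> integral_closure R K"
  unfolding integral_closure_def using ideal_power_mono[of J K] by blast

text \<open>Let \<open>L\<^bsup>s+1\<^esup> = J L\<^sup>s\<close>. Multiplication by \<open>x \<in> L\<close> maps \<open>L\<^sup>s\<close> into
  \<open>J L\<^sup>s\<close>, so by elimination on generators of \<open>L\<^sup>s\<close> a monic expression in \<open>x\<close> of some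
  degree \<open>e + 1\<close> kills \<open>L\<^sup>s\<close>. Since \<open>x\<^sup>s \<in> L\<^sup>s\<close>, its product with \<open>x\<^sup>s\<close> vanishes,
  and this product is monic of degree \<open>e + s + 1\<close>. Passing to this product is
  necessary because an element that kills \<open>L\<^sup>s\<close> may be nonzero.\<close>

lemma reduction_imp_integral:
  assumes "noetherian_ring R" and red: "reduction R J L" and L: "ideal L R" and xL: "x \<in> L"
  shows "x \<in> integral_closure R J"
proof -
  have J: "ideal J R" "J \<subseteq> L" using red by (auto simp: reduction_def)
  have x: "x \<in> carrier R" using ideal.Icarr[OF L xL] .
  obtain s where s: "ideal_power R L (Suc s) = J \<cdot> ideal_power R L s"
    using red by (auto simp: reduction_def)
  note iL = ideal_power_ideal[OF L] and iT = lower_terms_ideal[OF J(1) x]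
  obtain Y where Y: "Y \<subseteq> carrier R" "finite Y" "ideal_power R L s = Idl Y"
    using noetherian_ring.finetely_gen[OF assms(1) iL] by blast
  have "x [^] Suc 0 \<otimes> y \<in> lower_terms J x 0 \<cdot> (Idl Y)" if "y \<in> Y" for y
  proof -
    have "y \<in> ideal_power R L s" using that genideal_self[OF Y(1)] Y(3) by blast
    then have "y \<otimes> x \<in> J \<cdot> (Idl Y)"
      using ideal_prod.prod[of y "ideal_power R L s" x L R] xL s Y(3) by simp
    then show ?thesis
      using x that Y(1) by (simp add: lower_terms_def ideal_prod_one J m_comm subset_eq)
  qed
  from common_monic_annihilator[OF J(1) x Y(2,1) this] obtain e q where
    q: "q \<in> lower_terms J x e" and kill: "\<forall>y\<in>Y. (x [^] Suc e \<oplus> q) \<otimes> y = \<zero>"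
    by blast
  have qc: "q \<in> carrier R" using ideal.Icarr[OF iT q] .
  have "x [^] s \<in> Idl Y"
    using element_pow_in_ideal_power[OF L xL, of s] Y(3) by simp
  then have "(x [^] Suc e \<oplus> q) \<otimes> x [^] s = \<zero>"
    using annihilates_Idl[OF _ Y(1), of "x [^] Suc e \<oplus> q"] kill x qc by blast
  then have "x [^] Suc e \<otimes> x [^] s \<oplus> q \<otimes> x [^] s = \<zero>"
    using x qc by (simp add: l_distr)
  then have "x [^] Suc e \<otimes> x [^] s = \<ominus> (q \<otimes> x [^] s)"
    using x qc by (intro minus_equality[symmetric]) auto
  moreover have "x [^] Suc e \<otimes> x [^] s = x [^] Suc (e + s)"
    using nat_pow_mult[OF x, of "Suc e" s] by simp
  moreover have "\<ominus> (q \<otimes> x [^] s) \<in> lower_terms J x (e + s)"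
    by (rule additive_subgroup.a_inv_closed[OF ideal.axioms(1)[OF iT] lower_terms_mult_pow[OF J(1) x q]])
  ultimately show ?thesis
    unfolding integral_closure_iff[OF J(1) x] by metis
qed

lemma subset_integral_closure:
  assumes "noetherian_ring R" "ideal J R"
  shows "J \<subseteq> integral_closure R J"
  using reduction_imp_integral[OF assms(1) reduction_refl] assms(2) by blast

text \<open>Sums of integral elements are integral because adjoining two integral elements one after
  the other gives, by transitivity, an ideal of which \<open>J\<close> is a reduction, and all elements of
  such an ideal are integral.\<close>

lemma integral_closure_ideal:
  assumes N: "noetherian_ring R" and J: "ideal J R"
  shows "ideal (integral_closure R J) R"
proof (intro idealI ring_axioms add.subgroupI)
  show "integral_closure R J \<subseteq> carrier R" by (auto simp: integral_closure_def)
  show "integral_closure R J \<noteq> {}"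
    using subset_integral_closure[OF N J] additive_subgroup.zero_closed[OF ideal.axioms(1)[OF J]] by blast
next
  fix x assume x: "x \<in> integral_closure R J"
  have xc: "x \<in> carrier R" using x by (simp add: integral_closure_def)
  note A = adjoin_ideal[OF J xc] adjoin_self[OF J xc]
  note red = reduction_imp_integral[OF N reduction_adjoin[OF J x] A(1)]
  show "\<ominus> x \<in> integral_closure R J"
    using red additive_subgroup.a_inv_closed[OF ideal.axioms(1)[OF A(1)] A(2)] .
  fix a assume "a \<in> carrier R"
  then show "a \<otimes> x \<in> integral_closure R J" "x \<otimes> a \<in> integral_closure R J"
    using red ideal.I_l_closed[OF A] ideal.I_r_closed[OF A] by auto
next
  fix x y assume x: "x \<in> integral_closure R J" and y: "y \<in> integral_closure R J"
  have xc: "x \<in> carrier R" "y \<in> carrier R" using x y by (simp_all add: integral_closure_def)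
  let ?A = "adjoin J x" and ?B = "adjoin (adjoin J x) y"
  have A: "ideal ?A R" "J \<subseteq> ?A" using adjoin_ideal adjoin_upper J xc by auto
  have B: "ideal ?B R" "?A \<subseteq> ?B" using adjoin_ideal[OF A(1)] adjoin_upper[OF A(1)] xc by auto
  have "y \<in> integral_closure R ?A" using y integral_closure_mono[OF A(2)] by blast
  then have "reduction R J ?B"
    using reduction_trans[OF reduction_adjoin[OF J x] reduction_adjoin[OF A(1)] B(1)] by blast
  moreover have "x \<oplus> y \<in> ?B"
    using adjoin_self[OF J xc(1)] adjoin_self[OF A(1) xc(2)] B(2) by (intro ideal_add_closed[OF B(1)]) auto
  ultimately show "x \<oplus>\<^bsub>R\<^esub> y \<in> integral_closure R J"
    by (intro reduction_imp_integral[OF N _ B(1)])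
qed

text \<open>Adjoin the finitely many generators of \<open>I\<close> to \<open>J\<close> one at a time.\<close>

lemma integral_imp_reduction:
  assumes N: "noetherian_ring R" and J: "ideal J R" and I: "ideal I R" and "J \<subseteq> I"
    and int: "I \<subseteq> integral_closure R J"
  shows "reduction R J I"
proof -
  have *: "\<exists>B. ideal B R \<and> J \<subseteq> B \<and> Y \<subseteq> B \<and> B \<subseteq> I \<and> reduction R J B" if "finite Y" "Y \<subseteq> I" for Y
    using that
  proof (induction Y)
    case empty
    then show ?case using J \<open>J \<subseteq> I\<close> reduction_refl by blast
  next
    case (insert y Y)
    then obtain B where B: "ideal B R" "J \<subseteq> B" "Y \<subseteq> B" "B \<subseteq> I" "reduction R J B" by auto
    have y: "y \<in> integral_closure R B" "y \<in> carrier R"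
      using insert.prems int integral_closure_mono[OF B(2)] ideal.Icarr[OF I] by auto
    let ?C = "adjoin B y"
    have C: "ideal ?C R" "B \<subseteq> ?C" "y \<in> ?C" "?C \<subseteq> I"
      using adjoin_ideal adjoin_upper adjoin_self B y(2) adjoin_least[OF I B(4)] insert.prems by auto
    have "reduction R J ?C"
      by (rule reduction_trans[OF B(5) reduction_adjoin[OF B(1) y(1)] C(1)])
    with B C show ?case by (intro exI[of _ ?C]) auto
  qed
  obtain Y where Y: "Y \<subseteq> carrier R" "finite Y" "I = Idl Y"
    using noetherian_ring.finetely_gen[OF N I] by blast
  have "Y \<subseteq> I" using genideal_self[OF Y(1)] Y(3) by simp
  from *[OF Y(2) this] obtain B where B: "ideal B R" "Y \<subseteq> B" "B \<subseteq> I" "reduction R J B" by blast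
  then have "I \<subseteq> B" using genideal_minimal[OF B(1,2)] Y(3) by simp
  with B show ?thesis by auto
qed

theorem reduction_iff_integral_closure_eq:
  assumes N: "noetherian_ring R" and J: "ideal J R" and I: "ideal I R" and JI: "J \<subseteq> I"
  shows "reduction R J I \<longleftrightarrow> integral_closure R J = integral_closure R I"
proof
  assume red: "reduction R J I"
  have "x \<in> integral_closure R J" if x: "x \<in> integral_closure R I" for x
  proof -
    have xc: "x \<in> carrier R" using x by (simp add: integral_closure_def)
    have A: "ideal (adjoin I x) R" "x \<in> adjoin I x" using adjoin_ideal adjoin_self I xc by auto
    show ?thesis
      by (rule reduction_imp_integral[OF N reduction_trans[OF red reduction_adjoin[OF I x] A(1)] A])
  qed
  then show "integral_closure R J = integral_closure R I"
    using integral_closure_mono[OF JI] by blast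
next
  assume "integral_closure R J = integral_closure R I"
  then show "reduction R J I"
    using integral_imp_reduction[OF N J I JI] subset_integral_closure[OF N I] by blast
qed

end


section \<open>Annihilators\<close>

context module
begin

lemma annihilated_by_iff:
  "z \<in> annihilated_by R M K \<longleftrightarrow> z \<in> carrier M \<and> (\<forall>a\<in>K. a \<odot>\<^bsub>M\<^esub> z = \<zero>\<^bsub>M\<^esub>)"
  by (simp add: module_colon_def)

lemma annihilator_iff:
  "a \<in> annihilator R M A \<longleftrightarrow> a \<in> carrier R \<and> (\<forall>e\<in>A. a \<odot>\<^bsub>M\<^esub> e = \<zero>\<^bsub>M\<^esub>)"
  by (simp add: annihilator_def)

lemma annihilated_by_submodule:
  assumes "K \<subseteq> carrier R"
  shows "submodule (annihilated_by R M K) R M"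
proof (rule submoduleI)
  fix a x assume a: "a \<in> carrier R" and x: "x \<in> annihilated_by R M K"
  have "b \<odot>\<^bsub>M\<^esub> (a \<odot>\<^bsub>M\<^esub> x) = \<zero>\<^bsub>M\<^esub>" if b: "b \<in> K" for b
  proof -
    have bc: "b \<in> carrier R" and xc: "x \<in> carrier M" and bx: "b \<odot>\<^bsub>M\<^esub> x = \<zero>\<^bsub>M\<^esub>"
      using b assms x by (auto simp: annihilated_by_iff)
    have "b \<odot>\<^bsub>M\<^esub> (a \<odot>\<^bsub>M\<^esub> x) = (a \<otimes> b) \<odot>\<^bsub>M\<^esub> x"
      using a bc xc by (simp add: smult_assoc1[symmetric] R.m_comm)
    then show ?thesis using a bc xc bx by (simp add: smult_assoc1)
  qed
  then show "a \<odot>\<^bsub>M\<^esub> x \<in> annihilated_by R M K"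
    using a x by (simp add: annihilated_by_iff)
next
  show "a \<oplus>\<^bsub>M\<^esub> b \<in> annihilated_by R M K"
    if "a \<in> annihilated_by R M K" "b \<in> annihilated_by R M K" for a b
    using that assms by (auto simp: annihilated_by_iff smult_r_distr subset_eq)
  show "\<ominus>\<^bsub>M\<^esub> a \<in> annihilated_by R M K" if "a \<in> annihilated_by R M K" for a
    using that assms by (auto simp: annihilated_by_iff smult_r_minus subset_eq)
qed (use assms in \<open>auto simp: annihilated_by_iff\<close>)

lemma annihilator_ideal:
  assumes "A \<subseteq> carrier M"
  shows "ideal (annihilator R M A) R"
proof (intro idealI R.ring_axioms R.add.subgroupI)
  fix a x assume a: "a \<in> annihilator R M A" and x: "x \<in> carrier R"
  have "(x \<otimes> a) \<odot>\<^bsub>M\<^esub> e = \<zero>\<^bsub>M\<^esub>" if e: "e \<in> A" for e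
    using a x e assms by (auto simp: annihilator_iff smult_assoc1 subset_eq)
  then show "x \<otimes> a \<in> annihilator R M A" "a \<otimes> x \<in> annihilator R M A"
    using a x by (simp_all add: annihilator_iff R.m_comm)
next
  have "\<zero> \<in> annihilator R M A"
    using assms by (auto simp: annihilator_iff subset_eq)
  then show "annihilator R M A \<noteq> {}" by blast
qed (use assms in \<open>auto simp: annihilator_iff smult_l_distr smult_l_minus subset_eq\<close>)

lemma annihilator_antimono: "A \<subseteq> B \<Longrightarrow> annihilator R M B \<subseteq> annihilator R M A"
  unfolding annihilator_def by blast

lemma annihilated_by_antimono: "K \<subseteq> L \<Longrightarrow> annihilated_by R M L \<subseteq> annihilated_by R M K"
  unfolding module_colon_def by blast

lemma annihilator_galois:
  assumes "A \<subseteq> carrier M" "K \<subseteq> carrier R"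
  shows "A \<subseteq> annihilated_by R M K \<longleftrightarrow> K \<subseteq> annihilator R M A"
  using assms by (auto simp: annihilated_by_iff annihilator_iff subset_eq)

lemma annihilated_by_carrier: "annihilated_by R M K \<subseteq> carrier M"
  unfolding module_colon_def by blast

lemma annihilator_carrier: "annihilator R M A \<subseteq> carrier R"
  unfolding annihilator_def by blast

lemma subset_annihilated_by_annihilator:
  "A \<subseteq> carrier M \<Longrightarrow> A \<subseteq> annihilated_by R M (annihilator R M A)"
  by (auto simp: annihilated_by_iff annihilator_iff)

lemma subset_annihilator_annihilated_by:
  "K \<subseteq> carrier R \<Longrightarrow> K \<subseteq> annihilator R M (annihilated_by R M K)"
  by (auto simp: annihilated_by_iff annihilator_iff)

text \<open>This replaces a power of the maximal ideal by finitely many generators of it.\<close>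

lemma annihilated_by_Idl:
  assumes "Y \<subseteq> carrier R"
  shows "annihilated_by R M (Idl Y) = annihilated_by R M Y"
proof
  show "annihilated_by R M (Idl Y) \<subseteq> annihilated_by R M Y"
    by (rule annihilated_by_antimono[OF R.genideal_self[OF assms]])
  have "Idl Y \<subseteq> annihilator R M (annihilated_by R M Y)"
    by (intro R.genideal_minimal annihilator_ideal subset_annihilator_annihilated_by[OF assms]
        annihilated_by_carrier)
  then show "annihilated_by R M Y \<subseteq> annihilated_by R M (Idl Y)"
    using ideal.Icarr[OF R.genideal_ideal[OF assms]]
    by (subst annihilator_galois) (auto simp: annihilated_by_iff)
qed

lemma smult_minus_eq_zero_iff:
  assumes "a \<in> carrier R" "b \<in> carrier R" "x \<in> carrier M"
  shows "(a \<ominus> b) \<odot>\<^bsub>M\<^esub> x = \<zero>\<^bsub>M\<^esub> \<longleftrightarrow> a \<odot>\<^bsub>M\<^esub> x = b \<odot>\<^bsub>M\<^esub> x"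
proof -
  have "(a \<ominus> b) \<odot>\<^bsub>M\<^esub> x = a \<odot>\<^bsub>M\<^esub> x \<ominus>\<^bsub>M\<^esub> b \<odot>\<^bsub>M\<^esub> x"
    using assms by (simp add: a_minus_def smult_l_distr smult_l_minus)
  then show ?thesis
    using assms
    by (metis M.a_inv_closed M.minus_eq M.minus_equality M.minus_minus M.r_neg smult_closed)
qed

lemma smult_lcomm:
  "a \<in> carrier R \<Longrightarrow> b \<in> carrier R \<Longrightarrow> x \<in> carrier M \<Longrightarrow> a \<odot>\<^bsub>M\<^esub> (b \<odot>\<^bsub>M\<^esub> x) = b \<odot>\<^bsub>M\<^esub> (a \<odot>\<^bsub>M\<^esub> x)"
  by (simp add: smult_assoc1[symmetric] R.m_comm)

lemma cyclic_submodule: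
  assumes y: "y \<in> carrier M"
  shows "submodule {r \<odot>\<^bsub>M\<^esub> y |r. r \<in> carrier R} R M"
proof (rule submoduleI)
  let ?N = "{r \<odot>\<^bsub>M\<^esub> y |r. r \<in> carrier R}"
  show "\<zero>\<^bsub>M\<^esub> \<in> ?N" using y by (auto intro!: exI[of _ \<zero>])
  show "\<ominus>\<^bsub>M\<^esub> v \<in> ?N" if "v \<in> ?N" for v
    using that smult_l_minus[OF _ y] R.a_inv_closed by (smt (verit) mem_Collect_eq)
  show "v \<oplus>\<^bsub>M\<^esub> w \<in> ?N" if "v \<in> ?N" "w \<in> ?N" for v w
    using that smult_l_distr[OF _ _ y] R.add.m_closed by (smt (verit) mem_Collect_eq)
  show "a \<odot>\<^bsub>M\<^esub> w \<in> ?N" if "a \<in> carrier R" "w \<in> ?N" for a w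
    using that smult_assoc1[OF _ _ y] R.m_closed by (smt (verit) mem_Collect_eq)
qed (use y in auto)

lemma submodule_generated_submodule:
  assumes "S \<subseteq> carrier M"
  shows "submodule (submodule_generated R M S) R M"
proof (rule submoduleI)
  show "submodule_generated R M S \<subseteq> carrier M"
    unfolding submodule_generated_def using assms carrier_is_submodule by blast
qed (auto simp: submodule_generated_def submoduleE(3-5) submodule.smult_closed
      dest: subgroup.one_closed[OF submodule.axioms(1)])

lemma submodule_generated_upper: "S \<subseteq> submodule_generated R M S"
  unfolding submodule_generated_def by blast

lemma submodule_generated_least:
  "submodule N R M \<Longrightarrow> S \<subseteq> N \<Longrightarrow> submodule_generated R M S \<subseteq> N"
  unfolding submodule_generated_def by blast

lemma annihilator_submodule_generated:
  assumes "S \<subseteq> carrier M"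
  shows "annihilator R M (submodule_generated R M S) = annihilator R M S"
proof
  show "annihilator R M (submodule_generated R M S) \<subseteq> annihilator R M S"
    by (rule annihilator_antimono[OF submodule_generated_upper])
  have "submodule_generated R M S \<subseteq> annihilated_by R M (annihilator R M S)"
    by (intro submodule_generated_least annihilated_by_submodule subset_annihilated_by_annihilator
        assms annihilator_carrier)
  then show "annihilator R M S \<subseteq> annihilator R M (submodule_generated R M S)"
    using annihilator_galois[OF submoduleE(1)[OF submodule_generated_submodule[OF assms]]
        annihilator_carrier] by blast
qed

end


section \<open>Noetherian local rings\<close>

lemma (in noetherian_ring) exists_maximal_ideal_in_family:
  assumes "S \<noteq> {}" "\<And>K. K \<in> S \<Longrightarrow> ideal K R"
  shows "\<exists>P\<in>S. \<forall>K\<in>S. P \<subseteq> K \<longrightarrow> K = P"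
proof (rule subset_Zorn_nonempty[OF assms(1)])
  fix C assume "C \<noteq> {}" "subset.chain S C"
  then have "\<Union>C \<in> C" "C \<subseteq> S"
    using assms(2) ideal_chain_is_trivial[of C] unfolding pred_on.chain_def by blast+
  then show "\<Union>C \<in> S" by blast
qed

context complete_noetherian_local_ring
begin

lemma m_ideal: "ideal m R"
  using maximal by (rule maximalideal.axioms)

lemma m_carr: "a \<in> m \<Longrightarrow> a \<in> carrier R"
  using ideal.Icarr[OF m_ideal] .

lemma one_notin_m: "\<one> \<notin> m"
  using ideal.one_imp_carrier[OF m_ideal] maximalideal.I_notcarr[OF maximal] by metis

text \<open>An ideal that is maximal among the proper ideals containing \<open>P\<close> exists by the chain
  condition, and \<open>m\<close> is the only maximal ideal.\<close>

lemma proper_ideal_subset_m: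
  assumes P: "ideal P R" and "\<one> \<notin> P"
  shows "P \<subseteq> m"
proof -
  let ?S = "{K. ideal K R \<and> P \<subseteq> K \<and> \<one> \<notin> K}"
  have "?S \<noteq> {}" using assms by blast
  then obtain Q where Q: "Q \<in> ?S" "\<forall>K\<in>?S. Q \<subseteq> K \<longrightarrow> K = Q"
    using exists_maximal_ideal_in_family[of ?S] by blast
  have "maximalideal Q R"
  proof (rule maximalidealI)
    show "ideal Q R" "carrier R \<noteq> Q" using Q(1) one_closed by auto
    fix K assume K: "ideal K R" "Q \<subseteq> K" "K \<subseteq> carrier R"
    show "K = Q \<or> K = carrier R"
    proof (cases "\<one> \<in> K")
      case True
      then show ?thesis using ideal.one_imp_carrier[OF K(1)] by simp
    next
      case False
      then have "K \<in> ?S" using K Q(1) by blast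
      then show ?thesis using Q(2) K(2) by blast
    qed
  qed
  then have "Q = m" by (rule maximal_unique)
  then show ?thesis using Q(1) by blast
qed

lemma notin_m_invertible:
  assumes u: "u \<in> carrier R" "u \<notin> m"
  shows "\<exists>v\<in>carrier R. v \<otimes> u = \<one>"
proof (rule ccontr)
  assume "\<not> ?thesis"
  then have "\<one> \<notin> PIdl u" by (auto simp: cgenideal_def)
  then have "PIdl u \<subseteq> m" by (rule proper_ideal_subset_m[OF cgenideal_ideal[OF u(1)]])
  then show False using cgenideal_self[OF u(1)] u(2) by blast
qed

end


section \<open>Matlis duality\<close>

text \<open>The properties of the injective hull of the residue field from which Matlis duality is
  deduced: its socle is a simple module that meets every nonzero submodule, and linear maps from
  ideals extend to the ring (Baer's criterion). The socle is the set of elements killed by \<open>m\<close>,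
  so its simplicity says that each nonzero element generates it.\<close>

locale matlis_module = module R E + complete_noetherian_local_ring R m
  for R (structure) and m and E +
  assumes socle_nonzero: "\<exists>s\<in>carrier E. s \<noteq> \<zero>\<^bsub>E\<^esub> \<and> (\<forall>a\<in>m. a \<odot>\<^bsub>E\<^esub> s = \<zero>\<^bsub>E\<^esub>)"
    and socle_simple: "\<lbrakk>t \<in> carrier E; t \<noteq> \<zero>\<^bsub>E\<^esub>; \<forall>a\<in>m. a \<odot>\<^bsub>E\<^esub> t = \<zero>\<^bsub>E\<^esub>;
      t' \<in> carrier E; \<forall>a\<in>m. a \<odot>\<^bsub>E\<^esub> t' = \<zero>\<^bsub>E\<^esub>\<rbrakk> \<Longrightarrow> \<exists>u\<in>carrier R. t' = u \<odot>\<^bsub>E\<^esub> t"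
    and socle_essential: "\<lbrakk>submodule N R E; N \<noteq> {\<zero>\<^bsub>E\<^esub>}\<rbrakk> \<Longrightarrow>
      \<exists>t\<in>N. t \<noteq> \<zero>\<^bsub>E\<^esub> \<and> (\<forall>a\<in>m. a \<odot>\<^bsub>E\<^esub> t = \<zero>\<^bsub>E\<^esub>)"
    and baer: "\<lbrakk>ideal K R; f \<in> K \<rightarrow> carrier E;
      \<And>x y. x \<in> K \<Longrightarrow> y \<in> K \<Longrightarrow> f (x \<oplus> y) = f x \<oplus>\<^bsub>E\<^esub> f y;
      \<And>a x. a \<in> carrier R \<Longrightarrow> x \<in> K \<Longrightarrow> f (a \<otimes> x) = a \<odot>\<^bsub>E\<^esub> f x\<rbrakk> \<Longrightarrow>
      \<exists>e\<in>carrier E. \<forall>x\<in>K. f x = x \<odot>\<^bsub>E\<^esub> e"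
begin

abbreviation ann :: "'c set \<Rightarrow> 'a set" where
  "ann A \<equiv> annihilator R E A"

abbreviation perp :: "'a set \<Rightarrow> 'c set" where
  "perp K \<equiv> annihilated_by R E K"

text \<open>Let \<open>s\<close> be a nonzero socle element. The assignment \<open>k + ra \<mapsto> rs\<close> on \<open>K + Ra\<close> is well
  defined, because \<open>ra \<in> K\<close> with \<open>a \<notin> K\<close> forces \<open>r \<in> m\<close>. By Baer's criterion it is
  multiplication by an element \<open>e\<close>, for which \<open>Ke = 0\<close> and \<open>ae = s\<close>.\<close>

lemma exists_separating_element:
  assumes K: "ideal K R" and a: "a \<in> carrier R" "a \<notin> K"
  shows "\<exists>e\<in>perp K. a \<odot>\<^bsub>E\<^esub> e \<noteq> \<zero>\<^bsub>E\<^esub>"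
proof -
  interpret K: ideal K R by (rule K)
  obtain s where s: "s \<in> carrier E" "s \<noteq> \<zero>\<^bsub>E\<^esub>" "\<forall>a\<in>m. a \<odot>\<^bsub>E\<^esub> s = \<zero>\<^bsub>E\<^esub>"
    using socle_nonzero by blast
  let ?C = "{r \<in> carrier R. r \<otimes> a \<in> K}"
  have "ideal ?C R"
  proof (intro idealI R.ring_axioms R.add.subgroupI)
    fix x y assume "x \<in> ?C" "y \<in> carrier R"
    then show "y \<otimes> x \<in> ?C" "x \<otimes> y \<in> ?C"
      using a K.I_l_closed[of "x \<otimes> a" y] by (auto simp: R.m_assoc R.m_comm[of x y])
  qed (use a in \<open>auto simp: R.l_distr R.l_minus intro!: exI[of _ \<zero>]\<close>)
  then have C: "?C \<subseteq> m"
    using a by (intro proper_ideal_subset_m) auto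
  have wd: "r \<odot>\<^bsub>E\<^esub> s = r' \<odot>\<^bsub>E\<^esub> s"
    if r: "r \<in> carrier R" "r' \<in> carrier R" and k: "z \<ominus> r \<otimes> a \<in> K" "z \<ominus> r' \<otimes> a \<in> K" "z \<in> carrier R" for r r' z
  proof -
    have "(r \<ominus> r') \<otimes> a = (z \<ominus> r' \<otimes> a) \<oplus> \<ominus> (z \<ominus> r \<otimes> a)"
      using r a k(3) by algebra
    also have "\<dots> \<in> K" using k by (intro K.a_closed K.a_inv_closed)
    finally have "r \<ominus> r' \<in> m" using C r by auto
    then show ?thesis using s r by (simp add: smult_minus_eq_zero_iff[symmetric])
  qed
  define f where "f z = (SOME r. r \<in> carrier R \<and> z \<ominus> r \<otimes> a \<in> K) \<odot>\<^bsub>E\<^esub> s" for z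
  have f: "f z = r \<odot>\<^bsub>E\<^esub> s" if "r \<in> carrier R" "z \<ominus> r \<otimes> a \<in> K" "z \<in> carrier R" for r z
  proof -
    have "(SOME r. r \<in> carrier R \<and> z \<ominus> r \<otimes> a \<in> K) \<in> carrier R \<and>
        z \<ominus> (SOME r. r \<in> carrier R \<and> z \<ominus> r \<otimes> a \<in> K) \<otimes> a \<in> K"
      using that by (intro someI[of "\<lambda>r. r \<in> carrier R \<and> z \<ominus> r \<otimes> a \<in> K" r]) blast
    then show ?thesis unfolding f_def using that by (intro wd[of _ r z]) auto
  qed
  have rep: "\<exists>r\<in>carrier R. z \<ominus> r \<otimes> a \<in> K \<and> z \<in> carrier R" if z: "z \<in> R.adjoin K a" for z
  proof -
    obtain k r where k: "k \<in> K" "r \<in> carrier R" "z = k \<oplus> r \<otimes> a"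
      using z unfolding R.adjoin_def R.ideal_sum_iff cgenideal_def by blast
    have kc: "k \<in> carrier R" using K.Icarr[OF k(1)] .
    have "z \<ominus> r \<otimes> a = k" unfolding k(3) using a(1) kc k(2) by algebra
    moreover have "z \<in> carrier R" unfolding k(3) using a(1) kc k(2) by simp
    ultimately show ?thesis using k by (intro bexI[of _ r]) simp_all
  qed
  have A: "ideal (R.adjoin K a) R" "K \<subseteq> R.adjoin K a" "a \<in> R.adjoin K a"
    using R.adjoin_ideal R.adjoin_upper R.adjoin_self K a by auto
  have "\<exists>e\<in>carrier E. \<forall>z\<in>R.adjoin K a. f z = z \<odot>\<^bsub>E\<^esub> e"
  proof (rule baer[OF A(1)])
    show "f \<in> R.adjoin K a \<rightarrow> carrier E"
      using rep f s by (metis Pi_I smult_closed)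
  next
    fix x y assume x: "x \<in> R.adjoin K a" and y: "y \<in> R.adjoin K a"
    obtain r where r: "r \<in> carrier R" "x \<ominus> r \<otimes> a \<in> K" "x \<in> carrier R" using rep[OF x] by blast
    obtain t where t: "t \<in> carrier R" "y \<ominus> t \<otimes> a \<in> K" "y \<in> carrier R" using rep[OF y] by blast
    have "(x \<oplus> y) \<ominus> (r \<oplus> t) \<otimes> a = (x \<ominus> r \<otimes> a) \<oplus> (y \<ominus> t \<otimes> a)"
      using r(1,3) t(1,3) a(1) by algebra
    also have "\<dots> \<in> K" using r t by (intro K.a_closed)
    finally have "f (x \<oplus> y) = (r \<oplus> t) \<odot>\<^bsub>E\<^esub> s" using r t by (intro f) auto
    then show "f (x \<oplus> y) = f x \<oplus>\<^bsub>E\<^esub> f y"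
      using f[OF r] f[OF t] r t s by (simp add: smult_l_distr)
  next
    fix b x assume b: "b \<in> carrier R" and x: "x \<in> R.adjoin K a"
    obtain r where r: "r \<in> carrier R" "x \<ominus> r \<otimes> a \<in> K" "x \<in> carrier R" using rep[OF x] by blast
    have "b \<otimes> x \<ominus> (b \<otimes> r) \<otimes> a = b \<otimes> (x \<ominus> r \<otimes> a)"
      using r(1,3) b a(1) by algebra
    also have "\<dots> \<in> K" using r b by (intro K.I_l_closed)
    finally have "f (b \<otimes> x) = (b \<otimes> r) \<odot>\<^bsub>E\<^esub> s" using r b by (intro f) auto
    then show "f (b \<otimes> x) = b \<odot>\<^bsub>E\<^esub> f x"
      using f[OF r] r s b by (simp add: smult_assoc1)
  qed
  then obtain e where e: "e \<in> carrier E" "\<And>z. z \<in> R.adjoin K a \<Longrightarrow> f z = z \<odot>\<^bsub>E\<^esub> e" by blast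
  have "k \<odot>\<^bsub>E\<^esub> e = \<zero>\<^bsub>E\<^esub>" if k: "k \<in> K" for k
  proof -
    have "k \<ominus> \<zero> \<otimes> a = k" using K.Icarr[OF k] a by algebra
    then have "f k = \<zero> \<odot>\<^bsub>E\<^esub> s" using k K.Icarr[OF k] by (intro f) auto
    then show ?thesis using e(2)[of k] A k s by auto
  qed
  moreover have "a \<odot>\<^bsub>E\<^esub> e = s"
  proof -
    have "a \<ominus> \<one> \<otimes> a = \<zero>" using a(1) by algebra
    then have "a \<ominus> \<one> \<otimes> a \<in> K" by (simp only: K.zero_closed)
    then have "f a = \<one> \<odot>\<^bsub>E\<^esub> s" by (rule f[OF R.one_closed _ a(1)])
    then show ?thesis using e(2)[of a] A s by auto
  qed
  ultimately show ?thesis using e(1) s(2) by (auto simp: annihilated_by_iff)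
qed

theorem ann_perp:
  assumes K: "ideal K R"
  shows "ann (perp K) = K"
proof
  show "K \<subseteq> ann (perp K)"
    using ideal.Icarr[OF K] by (intro subset_annihilator_annihilated_by) blast
  show "ann (perp K) \<subseteq> K"
    using exists_separating_element[OF K] unfolding annihilator_def by blast
qed

lemma perp_mem: "e \<in> perp K \<Longrightarrow> a \<in> K \<Longrightarrow> a \<odot>\<^bsub>E\<^esub> e = \<zero>\<^bsub>E\<^esub>"
  by (simp add: annihilated_by_iff)

lemma perp_carr: "e \<in> perp K \<Longrightarrow> e \<in> carrier E"
  by (simp add: annihilated_by_iff)

text \<open>Otherwise choose an element \<open>y\<close> that is killed by no power of \<open>m\<close> and has the largest
  possible annihilator among these. If \<open>x \<in> m\<close> and \<open>xy\<close> were again of this kind, then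
  \<open>xy\<close> and \<open>y\<close> would have the same annihilator; but \<open>Ry\<close> contains a nonzero socle element
  \<open>ry\<close>, and \<open>r\<close> kills \<open>xy\<close> and not \<open>y\<close>. So \<open>xy\<close> is killed by a power of \<open>m\<close> for every
  \<open>x \<in> m\<close>, and as \<open>m\<close> is finitely generated one power suffices for all \<open>x\<close>. The next power
  then kills \<open>y\<close>.\<close>

lemma m_power_torsion:
  assumes e: "e \<in> carrier E"
  shows "\<exists>n. e \<in> perp (ideal_power R m n)"
proof (rule ccontr)
  assume bad: "\<not> ?thesis"
  define bad where "bad y \<longleftrightarrow> y \<in> carrier E \<and> (\<forall>n. y \<notin> perp (ideal_power R m n))" for y
  note mI = m_ideal and mP = R.ideal_power_ideal[OF m_ideal]
  let ?S = "{ann {y} |y. bad y}"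
  have "ann {e} \<in> ?S" using bad e by (auto simp: bad_def)
  moreover have "ideal K R" if "K \<in> ?S" for K
    using that by (auto simp: bad_def intro!: annihilator_ideal)
  ultimately obtain P where P: "P \<in> ?S" "\<forall>K\<in>?S. P \<subseteq> K \<longrightarrow> K = P"
    using exists_maximal_ideal_in_family[of ?S] by blast
  then obtain y where y: "bad y" "P = ann {y}" by blast
  have yc: "y \<in> carrier E" using y(1) by (simp add: bad_def)
  have good: "\<not> bad (x \<odot>\<^bsub>E\<^esub> y)" if x: "x \<in> m" for x
  proof
    assume "bad (x \<odot>\<^bsub>E\<^esub> y)"
    have xc: "x \<in> carrier R" using m_carr[OF x] .
    have "ann {y} \<subseteq> ann {x \<odot>\<^bsub>E\<^esub> y}"
      using xc yc by (auto simp: annihilator_iff smult_lcomm[of _ x y])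
    then have eq: "ann {x \<odot>\<^bsub>E\<^esub> y} = ann {y}"
      using P(2) \<open>bad (x \<odot>\<^bsub>E\<^esub> y)\<close> y(2) by blast
    let ?N = "{r \<odot>\<^bsub>E\<^esub> y |r. r \<in> carrier R}"
    have "submodule ?N R E" by (rule cyclic_submodule[OF yc])
    moreover have "y \<noteq> \<zero>\<^bsub>E\<^esub>"
    proof
      assume "y = \<zero>\<^bsub>E\<^esub>"
      then have "y \<in> perp (ideal_power R m 0)" by (auto simp: annihilated_by_iff)
      then show False using y(1) unfolding bad_def by blast
    qed
    then have "?N \<noteq> {\<zero>\<^bsub>E\<^esub>}" using smult_one[OF yc] R.one_closed by (smt (verit) mem_Collect_eq singletonD)
    ultimately obtain t where t: "t \<in> ?N" "t \<noteq> \<zero>\<^bsub>E\<^esub>" "\<forall>a\<in>m. a \<odot>\<^bsub>E\<^esub> t = \<zero>\<^bsub>E\<^esub>"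
      using socle_essential[of ?N] by blast
    then obtain r where r: "r \<in> carrier R" "t = r \<odot>\<^bsub>E\<^esub> y" by blast
    have "r \<odot>\<^bsub>E\<^esub> (x \<odot>\<^bsub>E\<^esub> y) = \<zero>\<^bsub>E\<^esub>"
      using t(3) x r(2) smult_lcomm[OF r(1) xc yc] by simp
    then have "r \<in> ann {x \<odot>\<^bsub>E\<^esub> y}" using r(1) by (simp add: annihilator_iff)
    then have "r \<in> ann {y}" unfolding eq .
    then show False using t(2) r(2) by (simp add: annihilator_iff)
  qed
  obtain Y where Y: "Y \<subseteq> carrier R" "finite Y" "m = Idl Y"
    using finetely_gen[OF mI] by blast
  have Ym: "Y \<subseteq> m" using R.genideal_self[OF Y(1)] Y(3) by simp
  have "\<exists>n. x \<odot>\<^bsub>E\<^esub> y \<in> perp (ideal_power R m n)" if "x \<in> Y" for x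
  proof -
    have "x \<odot>\<^bsub>E\<^esub> y \<in> carrier E" using that Ym m_carr yc by auto
    then show ?thesis using good[of x] that Ym unfolding bad_def by blast
  qed
  then obtain h where h: "\<And>x. x \<in> Y \<Longrightarrow> x \<odot>\<^bsub>E\<^esub> y \<in> perp (ideal_power R m (h x))" by metis
  define n where "n = Max (insert 0 (h ` Y))"
  have kill: "x \<odot>\<^bsub>E\<^esub> y \<in> perp (ideal_power R m n)" if x: "x \<in> Y" for x
  proof -
    have "h x \<le> n" unfolding n_def using Y(2) x by (intro Max_ge) auto
    then have "ideal_power R m n \<subseteq> ideal_power R m (h x)" by (rule R.ideal_power_decreasing[OF mI])
    then show ?thesis using h[OF x] annihilated_by_antimono by blast
  qed
  have "b \<in> ann {a \<odot>\<^bsub>E\<^esub> y}" if b: "b \<in> ideal_power R m n" and a: "a \<in> m" for a b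
  proof -
    have bc: "b \<in> carrier R" using ideal.Icarr[OF mP b] .
    have "m \<subseteq> ann {b \<odot>\<^bsub>E\<^esub> y}"
      unfolding Y(3)
    proof (intro R.genideal_minimal annihilator_ideal subsetI)
      fix x assume x: "x \<in> Y"
      then have "b \<odot>\<^bsub>E\<^esub> (x \<odot>\<^bsub>E\<^esub> y) = \<zero>\<^bsub>E\<^esub>" using perp_mem[OF kill b] by blast
      then show "x \<in> ann {b \<odot>\<^bsub>E\<^esub> y}"
        using x Y(1) smult_lcomm[OF bc _ yc, of x] by (auto simp: annihilator_iff)
    qed (use bc yc in auto)
    then show ?thesis
      using a m_carr[OF a] bc smult_lcomm[OF bc m_carr[OF a] yc] by (auto simp: annihilator_iff)
  qed
  then have "b \<otimes> a \<in> ann {y}" if "b \<in> ideal_power R m n" "a \<in> m" for a b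
    using that ideal.Icarr[OF mP that(1)] m_carr[OF that(2)] yc
    by (simp add: annihilator_iff smult_assoc1)
  then have "ideal_power R m (Suc n) \<subseteq> ann {y}"
    unfolding R.ideal_power_Suc using yc by (intro R.ideal_prod_least annihilator_ideal) auto
  then have "y \<in> perp (ideal_power R m (Suc n))"
    using yc unfolding annihilated_by_iff annihilator_def by blast
  then show False using y(1) unfolding bad_def by blast
qed

text \<open>Call a submodule \<open>C\<close> closed if every element killed by \<open>(0 :\<^sub>R C)\<close> lies in \<open>C\<close>.
  Here \<open>D = C + Re\<close> with \<open>me \<subseteq> C\<close>, so \<open>D\<close> is larger than \<open>C\<close> by at most a simple
  module. The map \<open>a \<mapsto> ae\<close> embeds \<open>(0 :\<^sub>R C) / (0 :\<^sub>R D)\<close> into the simple socle, so the annihilators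
  differ by at most a simple module as well, and passing to annihilators once more cannot
  give more than \<open>D\<close>. This is the usual length count, carried out on elements.\<close>

lemma closed_extension:
  assumes C: "submodule C R E" "perp (ann C) \<subseteq> C" and D: "submodule D R E" "C \<subseteq> D"
    and e: "e \<in> D" "\<And>a. a \<in> m \<Longrightarrow> a \<odot>\<^bsub>E\<^esub> e \<in> C"
    and gen: "\<And>d. d \<in> D \<Longrightarrow> \<exists>c\<in>C. \<exists>u\<in>carrier R. d = c \<oplus>\<^bsub>E\<^esub> u \<odot>\<^bsub>E\<^esub> e"
  shows "perp (ann D) \<subseteq> D"
proof -
  note Cs = submoduleE[OF C(1)] and Ds = submoduleE[OF D(1)]
  have ec: "e \<in> carrier E" using e(1) Ds(1) by blast
  have annD: "a \<in> ann D" if a: "a \<in> ann C" "a \<odot>\<^bsub>E\<^esub> e = \<zero>\<^bsub>E\<^esub>" for a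
  proof -
    have ac: "a \<in> carrier R" "\<And>c. c \<in> C \<Longrightarrow> a \<odot>\<^bsub>E\<^esub> c = \<zero>\<^bsub>E\<^esub>" using a(1) by (auto simp: annihilator_iff)
    have "a \<odot>\<^bsub>E\<^esub> d = \<zero>\<^bsub>E\<^esub>" if "d \<in> D" for d
    proof -
      obtain c u where c: "c \<in> C" "u \<in> carrier R" "d = c \<oplus>\<^bsub>E\<^esub> u \<odot>\<^bsub>E\<^esub> e" using gen[OF \<open>d \<in> D\<close>] by blast
      have "a \<odot>\<^bsub>E\<^esub> d = a \<odot>\<^bsub>E\<^esub> c \<oplus>\<^bsub>E\<^esub> u \<odot>\<^bsub>E\<^esub> (a \<odot>\<^bsub>E\<^esub> e)"
        using c ac(1) ec Cs(1) by (auto simp: smult_r_distr smult_lcomm[of a u e])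
      then show ?thesis using ac(2)[OF c(1)] a(2) c(2) by simp
    qed
    then show ?thesis using ac(1) by (simp add: annihilator_iff)
  qed
  have soc: "b \<odot>\<^bsub>E\<^esub> (a \<odot>\<^bsub>E\<^esub> e) = \<zero>\<^bsub>E\<^esub>" if a: "a \<in> ann C" and b: "b \<in> m" for a b
    using a e(2)[OF b] smult_lcomm[OF m_carr[OF b] _ ec, of a] by (simp add: annihilator_iff)
  show ?thesis
  proof (cases "\<exists>x\<in>ann C. x \<odot>\<^bsub>E\<^esub> e \<noteq> \<zero>\<^bsub>E\<^esub>")
    case False
    then have "ann C \<subseteq> ann D" using annD by blast
    then show ?thesis using annihilated_by_antimono C(2) D(2) by blast
  next
    case True
    \<comment> \<open>Modulo \<open>ann D\<close>, such an \<open>x\<close> generates \<open>ann C\<close>.\<close>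
    then obtain x where x: "x \<in> ann C" "x \<odot>\<^bsub>E\<^esub> e \<noteq> \<zero>\<^bsub>E\<^esub>" by blast
    have xc: "x \<in> carrier R" using x(1) by (simp add: annihilator_iff)
    show ?thesis
    proof
      fix d assume d: "d \<in> perp (ann D)"
      have dc: "d \<in> carrier E" using perp_carr[OF d] .
      have "b \<odot>\<^bsub>E\<^esub> (x \<odot>\<^bsub>E\<^esub> d) = \<zero>\<^bsub>E\<^esub>" if b: "b \<in> m" for b
      proof -
        have bc: "b \<in> carrier R" using m_carr[OF b] .
        have "b \<otimes> x \<in> ann C"
          using ideal.I_l_closed[OF annihilator_ideal[OF Cs(1)] x(1) bc] .
        moreover have "(b \<otimes> x) \<odot>\<^bsub>E\<^esub> e = \<zero>\<^bsub>E\<^esub>" using soc[OF x(1) b] bc xc ec by (simp add: smult_assoc1)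
        ultimately have "(b \<otimes> x) \<odot>\<^bsub>E\<^esub> d = \<zero>\<^bsub>E\<^esub>" by (intro perp_mem[OF d] annD)
        then show ?thesis using bc xc dc by (simp add: smult_assoc1)
      qed
      \<comment> \<open>An element \<open>d\<close> killed by \<open>ann D\<close> has the same product with \<open>x\<close> as some \<open>u e\<close>, and then the
        difference \<open>c\<close> is killed by all of \<open>ann C\<close>.\<close>
      then obtain u where u: "u \<in> carrier R" "x \<odot>\<^bsub>E\<^esub> d = u \<odot>\<^bsub>E\<^esub> (x \<odot>\<^bsub>E\<^esub> e)"
        using socle_simple[of "x \<odot>\<^bsub>E\<^esub> e" "x \<odot>\<^bsub>E\<^esub> d"] x(2) xc ec dc soc[OF x(1)] by auto
      define c where "c = d \<ominus>\<^bsub>E\<^esub> u \<odot>\<^bsub>E\<^esub> e"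
      have cc: "c \<in> carrier E" using dc u ec by (simp add: c_def)
      have "a \<odot>\<^bsub>E\<^esub> c = \<zero>\<^bsub>E\<^esub>" if a: "a \<in> ann C" for a
      proof -
        have ac: "a \<in> carrier R" using a by (simp add: annihilator_iff)
        obtain w where w: "w \<in> carrier R" "a \<odot>\<^bsub>E\<^esub> e = w \<odot>\<^bsub>E\<^esub> (x \<odot>\<^bsub>E\<^esub> e)"
          using socle_simple[of "x \<odot>\<^bsub>E\<^esub> e" "a \<odot>\<^bsub>E\<^esub> e"] x(2) xc ac ec soc[OF x(1)] soc[OF a] by auto
        have "a \<ominus> w \<otimes> x \<in> ann C"
          using ideal.I_l_closed[OF annihilator_ideal[OF Cs(1)] x(1) w(1)] a
            additive_subgroup.a_inv_closed[OF ideal.axioms(1)[OF annihilator_ideal[OF Cs(1)]]]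
          unfolding a_minus_def by (intro R.ideal_add_closed annihilator_ideal Cs(1)) auto
        moreover have "(a \<ominus> w \<otimes> x) \<odot>\<^bsub>E\<^esub> e = \<zero>\<^bsub>E\<^esub>"
          using w ac xc ec by (simp add: smult_minus_eq_zero_iff smult_assoc1)
        ultimately have "(a \<ominus> w \<otimes> x) \<odot>\<^bsub>E\<^esub> d = \<zero>\<^bsub>E\<^esub>" by (intro perp_mem[OF d] annD)
        then have "a \<odot>\<^bsub>E\<^esub> d = w \<odot>\<^bsub>E\<^esub> (x \<odot>\<^bsub>E\<^esub> d)"
          using w ac xc dc by (simp add: smult_minus_eq_zero_iff smult_assoc1)
        also have "\<dots> = a \<odot>\<^bsub>E\<^esub> (u \<odot>\<^bsub>E\<^esub> e)"
          using w u ac xc ec smult_lcomm[of w u "x \<odot>\<^bsub>E\<^esub> e"] smult_lcomm[of a u e] by simp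
        finally show ?thesis
          using ac u dc ec by (simp add: c_def a_minus_def smult_r_distr smult_r_minus M.r_neg)
      qed
      then have "c \<in> C" using C(2) cc by (auto simp: annihilated_by_iff)
      moreover have "d = c \<oplus>\<^bsub>E\<^esub> u \<odot>\<^bsub>E\<^esub> e"
        using dc u ec by (simp add: c_def a_minus_def M.a_assoc M.l_neg)
      ultimately show "d \<in> D" using D(2) Ds(4)[OF u(1) e(1)] Ds(5) by blast
    qed
  qed
qed

text \<open>Multiplication by \<open>x\<close> maps \<open>D\<close> into the socle, since \<open>mx\<close> lies in \<open>S\<close> and kills
  \<open>D\<close>. The kernel \<open>C\<close> is closed by hypothesis, and \<open>D\<close> is \<open>C\<close> or an extension of it by
  one generator.\<close>

lemma closed_step:
  assumes x: "x \<in> carrier R" and mx: "\<And>a. a \<in> m \<Longrightarrow> a \<otimes> x \<in> S" and S: "S \<subseteq> carrier R"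
    and IH: "\<And>C. submodule C R E \<Longrightarrow> C \<subseteq> perp (insert x S) \<Longrightarrow> perp (ann C) \<subseteq> C"
    and D: "submodule D R E" "D \<subseteq> perp S"
  shows "perp (ann D) \<subseteq> D"
proof -
  note Ds = submoduleE[OF D(1)]
  have z: "\<zero>\<^bsub>E\<^esub> \<in> D" using subgroup.one_closed[OF submodule.axioms(1)[OF D(1)]] by simp
  have Dc: "d \<in> carrier E" if "d \<in> D" for d using that Ds(1) by blast
  define C where "C = D \<inter> perp {x}"
  have Cs: "submodule C R E"
    unfolding C_def
  proof (rule submoduleI)
    note P = submoduleE[OF annihilated_by_submodule[of "{x}"]]
    show "D \<inter> perp {x} \<subseteq> carrier E" using Ds(1) by blast
    show "\<zero>\<^bsub>E\<^esub> \<in> D \<inter> perp {x}" using z x by (simp add: annihilated_by_iff)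
  qed (use Ds submoduleE[OF annihilated_by_submodule[of "{x}"]] x in auto)
  have "C \<subseteq> perp (insert x S)" using D(2) unfolding C_def by (auto simp: annihilated_by_iff)
  then have Cc: "perp (ann C) \<subseteq> C" by (rule IH[OF Cs])
  have soc: "a \<odot>\<^bsub>E\<^esub> (x \<odot>\<^bsub>E\<^esub> d) = \<zero>\<^bsub>E\<^esub>" if "d \<in> D" "a \<in> m" for a d
    using perp_mem[of d S "a \<otimes> x"] D(2) mx[OF that(2)] that Dc[OF that(1)] x m_carr[OF that(2)]
    by (auto simp: smult_assoc1)
  show ?thesis
  proof (cases "D \<subseteq> C")
    case True
    then have "D = C" unfolding C_def by blast
    then show ?thesis using Cc by simp
  next
    case False
    then obtain e where e: "e \<in> D" "x \<odot>\<^bsub>E\<^esub> e \<noteq> \<zero>\<^bsub>E\<^esub>"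
      using Dc unfolding C_def module_colon_def by blast
    have ec: "e \<in> carrier E" using Dc[OF e(1)] .
    show ?thesis
    proof (rule closed_extension[OF Cs Cc D(1) _ e(1)])
      show "C \<subseteq> D" unfolding C_def by blast
      show "a \<odot>\<^bsub>E\<^esub> e \<in> C" if "a \<in> m" for a
        using soc[OF e(1) that] Ds(4)[OF m_carr[OF that] e(1)] m_carr[OF that] x ec
          smult_lcomm[OF x m_carr[OF that] ec]
        unfolding C_def by (simp add: annihilated_by_iff)
    next
      fix d assume d: "d \<in> D"
      have dc: "d \<in> carrier E" using Dc[OF d] .
      obtain u where u: "u \<in> carrier R" "x \<odot>\<^bsub>E\<^esub> d = u \<odot>\<^bsub>E\<^esub> (x \<odot>\<^bsub>E\<^esub> e)"
        using socle_simple[of "x \<odot>\<^bsub>E\<^esub> e" "x \<odot>\<^bsub>E\<^esub> d"] e(2) x ec dc soc[OF e(1)] soc[OF d] by auto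
      let ?c = "d \<ominus>\<^bsub>E\<^esub> u \<odot>\<^bsub>E\<^esub> e"
      have "?c \<in> D"
        unfolding a_minus_def using Ds(3)[OF Ds(4)[OF u(1) e(1)]] Ds(5)[OF d] by blast
      moreover have "x \<odot>\<^bsub>E\<^esub> ?c = \<zero>\<^bsub>E\<^esub>"
        using x u dc ec smult_lcomm[OF x u(1) ec]
        by (simp add: a_minus_def smult_r_distr smult_r_minus M.r_neg)
      ultimately have "?c \<in> C" unfolding C_def using Dc by (simp add: annihilated_by_iff)
      moreover have "d = ?c \<oplus>\<^bsub>E\<^esub> u \<odot>\<^bsub>E\<^esub> e"
        using dc u ec by (simp add: a_minus_def M.a_assoc M.l_neg)
      ultimately show "\<exists>c\<in>C. \<exists>u\<in>carrier R. d = c \<oplus>\<^bsub>E\<^esub> u \<odot>\<^bsub>E\<^esub> e" using u(1) by blast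
    qed
  qed
qed

lemma closed_steps:
  assumes "finite Y" "Y \<subseteq> carrier R" "S \<subseteq> carrier R" "\<And>a y. a \<in> m \<Longrightarrow> y \<in> Y \<Longrightarrow> a \<otimes> y \<in> S"
    and "\<And>C. submodule C R E \<Longrightarrow> C \<subseteq> perp (Y \<union> S) \<Longrightarrow> perp (ann C) \<subseteq> C"
    and "submodule D R E" "D \<subseteq> perp S"
  shows "perp (ann D) \<subseteq> D"
  using assms
proof (induction Y arbitrary: S D rule: finite_induct)
  case empty
  then show ?case by simp
next
  case (insert y Y)
  show ?case
  proof (rule closed_step[OF _ _ insert.prems(2) _ insert.prems(5,6)])
    show "y \<in> carrier R" using insert.prems(1) by blast
    show "a \<otimes> y \<in> S" if "a \<in> m" for a using insert.prems(3)[OF that] by blast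
    fix C assume C: "submodule C R E" "C \<subseteq> perp (insert y S)"
    show "perp (ann C) \<subseteq> C"
    proof (rule insert.IH[OF _ _ _ _ C])
      show "Y \<subseteq> carrier R" "insert y S \<subseteq> carrier R" using insert.prems(1,2) by auto
      show "a \<otimes> y' \<in> insert y S" if "a \<in> m" "y' \<in> Y" for a y' using insert.prems(3) that by blast
      show "perp (ann C') \<subseteq> C'" if "submodule C' R E" "C' \<subseteq> perp (Y \<union> insert y S)" for C'
        using insert.prems(4)[OF that(1)] that(2) by simp
    qed
  qed
qed

text \<open>The passage from \<open>m\<^sup>n\<close> to \<open>m\<^bsup>n+1\<^esup>\<close> drops the generators of \<open>m\<^sup>n\<close> from the
  annihilating set one at a time, and \<open>m\<close> times such a generator stays in it.\<close>

lemma m_torsion_submodule_closed: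
  assumes "submodule C R E" "C \<subseteq> perp (ideal_power R m n)"
  shows "perp (ann C) \<subseteq> C"
  using assms
proof (induction n arbitrary: C)
  case 0
  have "C = {\<zero>\<^bsub>E\<^esub>}"
  proof
    show "C \<subseteq> {\<zero>\<^bsub>E\<^esub>}"
    proof
      fix c assume c: "c \<in> C"
      then have "c \<in> perp (carrier R)" using "0.prems"(2) by auto
      then have "\<one> \<odot>\<^bsub>E\<^esub> c = \<zero>\<^bsub>E\<^esub>" "c \<in> carrier E" by (auto simp: annihilated_by_iff)
      then show "c \<in> {\<zero>\<^bsub>E\<^esub>}" by simp
    qed
    show "{\<zero>\<^bsub>E\<^esub>} \<subseteq> C" using subgroup.one_closed[OF submodule.axioms(1)[OF "0.prems"(1)]] by simp
  qed
  moreover have "c = \<zero>\<^bsub>E\<^esub>" if "c \<in> perp (ann {\<zero>\<^bsub>E\<^esub>})" for c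
    using perp_mem[OF that, of \<one>] perp_carr[OF that] by (simp add: annihilator_iff)
  ultimately show ?case by blast
next
  case (Suc n)
  note mP = R.ideal_power_ideal[OF m_ideal]
  obtain Y where Y: "Y \<subseteq> carrier R" "finite Y" "ideal_power R m n = Idl Y"
    using finetely_gen[OF mP] by blast
  show ?case
  proof (rule closed_steps[OF Y(2,1) _ _ _ Suc.prems])
    show "ideal_power R m (Suc n) \<subseteq> carrier R" using ideal.Icarr[OF mP] by blast
    show "a \<otimes> y \<in> ideal_power R m (Suc n)" if a: "a \<in> m" and y: "y \<in> Y" for a y
    proof -
      have "y \<in> ideal_power R m n" using y R.genideal_self[OF Y(1)] Y(3) by blast
      then have "y \<otimes> a \<in> ideal_power R m (Suc n)"
        unfolding R.ideal_power_Suc using a by (intro ideal_prod.prod)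
      moreover have "y \<otimes> a = a \<otimes> y" using y Y(1) m_carr[OF a] by (intro R.m_comm) auto
      ultimately show ?thesis by (simp only:)
    qed
    fix C' assume C': "submodule C' R E" "C' \<subseteq> perp (Y \<union> ideal_power R m (Suc n))"
    have "perp (Y \<union> ideal_power R m (Suc n)) \<subseteq> perp (ideal_power R m n)"
      unfolding Y(3) annihilated_by_Idl[OF Y(1)] by (rule annihilated_by_antimono) simp
    then show "perp (ann C') \<subseteq> C'" using Suc.IH[OF C'(1)] C'(2) by blast
  qed
qed

text \<open>For submodules that are not killed by one power of \<open>m\<close> completeness is needed. Write \<open>C\<close> as the
  union of its closed parts \<open>L n\<close> killed by \<open>m\<^sup>n\<close>. For \<open>e \<notin> C\<close> some element of
  \<open>ann (L N)\<close> does not kill \<open>e\<close>. Duality gives \<open>ann (L n) \<subseteq> ann (L (n + 1)) + m\<^sup>n\<close>, because both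
  sides are ideals and the submodule killed by the right hand side is contained in
  \<open>L (n + 1)\<close> and killed by \<open>m\<^sup>n\<close>. So that element can be corrected step by step to kill larger
  and larger parts of \<open>C\<close>, by amounts that tend to \<open>0\<close> and do not affect its action on \<open>e\<close>.
  The limit kills \<open>C\<close> and does not kill \<open>e\<close>.\<close>

theorem perp_ann:
  assumes C: "submodule C R E"
  shows "perp (ann C) = C"
proof (intro equalityI subset_annihilated_by_annihilator[OF submoduleE(1)[OF C]] subsetI, rule ccontr)
  fix e assume e: "e \<in> perp (ann C)" and eC: "e \<notin> C"
  have ec: "e \<in> carrier E" using perp_carr[OF e] .
  note Cs = submoduleE[OF C] and mP = R.ideal_power_ideal[OF m_ideal]
    and dec = R.ideal_power_decreasing[OF m_ideal]
  have Pc: "ideal_power R m n \<subseteq> carrier R" for n using ideal.Icarr[OF mP] by blast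
  define L where "L n = C \<inter> perp (ideal_power R m n)" for n
  have Ls: "submodule (L n) R E" for n
    unfolding L_def
  proof (rule submoduleI)
    show "C \<inter> perp (ideal_power R m n) \<subseteq> carrier E" using Cs(1) by blast
    show "\<zero>\<^bsub>E\<^esub> \<in> C \<inter> perp (ideal_power R m n)"
      using subgroup.one_closed[OF submodule.axioms(1)[OF C]] Pc by (auto simp: annihilated_by_iff subset_eq)
  qed (use Cs submoduleE[OF annihilated_by_submodule[OF Pc]] in auto)
  have Lclosed: "perp (ann (L n)) \<subseteq> L n" for n
    by (rule m_torsion_submodule_closed[OF Ls, of n n]) (simp add: L_def)
  have Lann: "ideal (ann (L n)) R" for n
    by (rule annihilator_ideal[OF submoduleE(1)[OF Ls]])
  have lift: "\<exists>b\<in>ann (L (Suc n)). a \<ominus> b \<in> ideal_power R m n" if a: "a \<in> ann (L n)" for n a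
  proof -
    let ?K = "ann (L (Suc n)) <+> ideal_power R m n :: 'a set"
    have K: "ideal ?K R" by (rule R.add_ideals[OF Lann mP])
    have "perp ?K \<subseteq> perp (ann (L (Suc n)))" "perp ?K \<subseteq> perp (ideal_power R m n)"
      by (intro annihilated_by_antimono R.ideal_sum_upper1 R.ideal_sum_upper2 Lann mP)+
    then have "perp ?K \<subseteq> L n" using Lclosed[of "Suc n"] unfolding L_def by blast
    then have "a \<in> ?K" using annihilator_antimono ann_perp[OF K] a by blast
    then obtain b k where b: "b \<in> ann (L (Suc n))" and k: "k \<in> ideal_power R m n" and eq: "a = b \<oplus> k"
      unfolding R.ideal_sum_iff by blast
    have "b \<in> carrier R" "k \<in> carrier R" using ideal.Icarr[OF Lann b] ideal.Icarr[OF mP k] .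
    then have "a \<ominus> b = k" unfolding eq by algebra
    then show ?thesis using b k by blast
  qed
  obtain N where N: "e \<in> perp (ideal_power R m N)" using m_power_torsion[OF ec] by blast
  have "e \<notin> perp (ann (L N))" using Lclosed[of N] eC unfolding L_def by blast
  then obtain r0 where r0: "r0 \<in> ann (L N)" "r0 \<odot>\<^bsub>E\<^esub> e \<noteq> \<zero>\<^bsub>E\<^esub>" using ec unfolding annihilated_by_iff by blast
  let ?P = "\<lambda>n x. x \<in> ann (L (N + n)) \<and> x \<odot>\<^bsub>E\<^esub> e = r0 \<odot>\<^bsub>E\<^esub> e"
  let ?Q = "\<lambda>n x y. x \<ominus> y \<in> ideal_power R m (N + n)"
  have "\<exists>x. \<forall>n. ?P n (x n) \<and> ?Q n (x n) (x (Suc n))"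
  proof (rule dependent_nat_choice)
    show "\<exists>x. ?P 0 x" using r0 by auto
    fix x n assume x: "?P n x"
    obtain y where y: "y \<in> ann (L (N + Suc n))" "?Q n x y" using lift[of x "N + n"] x by auto
    have "x \<ominus> y \<in> ideal_power R m N" using dec[of N "N + n"] y(2) by auto
    then have "(x \<ominus> y) \<odot>\<^bsub>E\<^esub> e = \<zero>\<^bsub>E\<^esub>" by (rule perp_mem[OF N])
    moreover have "x \<in> carrier R" "y \<in> carrier R" using x y(1) by (simp_all add: annihilator_iff)
    ultimately have "y \<odot>\<^bsub>E\<^esub> e = r0 \<odot>\<^bsub>E\<^esub> e" using x ec by (simp add: smult_minus_eq_zero_iff)
    with y show "\<exists>y. ?P (Suc n) y \<and> ?Q n x y" by blast
  qed
  then obtain x where x: "\<And>n. x n \<in> ann (L (N + n))" "\<And>n. x n \<odot>\<^bsub>E\<^esub> e = r0 \<odot>\<^bsub>E\<^esub> e"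
    "\<And>n. x n \<ominus> x (Suc n) \<in> ideal_power R m (N + n)" by blast
  have xc: "x n \<in> carrier R" for n using x(1) by (simp add: annihilator_iff)
  have step: "x k \<ominus> x (k + j) \<in> ideal_power R m k" for k j
  proof (induction j)
    case 0
    have "x k \<ominus> x k = \<zero>" using xc[of k] by algebra
    then show ?case using additive_subgroup.zero_closed[OF ideal.axioms(1)[OF mP]] by simp
  next
    case (Suc j)
    have "x (k + j) \<ominus> x (Suc (k + j)) \<in> ideal_power R m k"
      using x(3)[of "k + j"] dec[of k "N + (k + j)"] by auto
    then have "(x k \<ominus> x (k + j)) \<oplus> (x (k + j) \<ominus> x (Suc (k + j))) \<in> ideal_power R m k"
      using Suc by (intro R.ideal_add_closed[OF mP])
    moreover have "(x k \<ominus> x (k + j)) \<oplus> (x (k + j) \<ominus> x (Suc (k + j))) = x k \<ominus> x (Suc (k + j))"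
      using xc[of k] xc[of "k + j"] xc[of "Suc (k + j)"] by algebra
    ultimately show ?case by simp
  qed
  have "adic_Cauchy R m x"
    unfolding adic_Cauchy_def
  proof (intro allI exI impI)
    fix k i j :: nat assume ij: "k \<le> i" "k \<le> j"
    have "x k \<ominus> x i \<in> ideal_power R m k" "x k \<ominus> x j \<in> ideal_power R m k"
      using step[of k "i - k"] step[of k "j - k"] ij by simp_all
    then have "\<ominus> (x k \<ominus> x i) \<oplus> (x k \<ominus> x j) \<in> ideal_power R m k"
      by (intro R.ideal_add_closed[OF mP] additive_subgroup.a_inv_closed[OF ideal.axioms(1)[OF mP]])
    moreover have "\<ominus> (x k \<ominus> x i) \<oplus> (x k \<ominus> x j) = x i \<ominus> x j"
      using xc[of k] xc[of i] xc[of j] by algebra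
    ultimately show "x i \<ominus> x j \<in> ideal_power R m k" by simp
  qed
  then obtain y where y: "y \<in> carrier R" "adic_limit R m x y"
    using complete[of x] xc by blast
  \<comment> \<open>On each single element of \<open>E\<close> the limit acts like a late term of the sequence.\<close>
  have lim: "\<exists>i\<ge>n. x i \<odot>\<^bsub>E\<^esub> z = y \<odot>\<^bsub>E\<^esub> z" if z: "z \<in> perp (ideal_power R m n)" for z n
  proof -
    obtain k where k: "\<forall>i\<ge>k. x i \<ominus> y \<in> ideal_power R m n"
      using y(2) unfolding adic_limit_def by blast
    have "(x (max k n) \<ominus> y) \<odot>\<^bsub>E\<^esub> z = \<zero>\<^bsub>E\<^esub>" using k by (intro perp_mem[OF z]) simp
    then show ?thesis
      using xc y(1) perp_carr[OF z] by (intro exI[of _ "max k n"]) (simp add: smult_minus_eq_zero_iff)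
  qed
  have "y \<odot>\<^bsub>E\<^esub> c = \<zero>\<^bsub>E\<^esub>" if c: "c \<in> C" for c
  proof -
    obtain n where n: "c \<in> perp (ideal_power R m n)" using m_power_torsion Cs(1) c by blast
    obtain i where i: "i \<ge> n" "x i \<odot>\<^bsub>E\<^esub> c = y \<odot>\<^bsub>E\<^esub> c" using lim[OF n] by blast
    have "c \<in> perp (ideal_power R m (N + i))"
      using n annihilated_by_antimono[OF dec[of n "N + i"]] i(1) by auto
    then have "c \<in> L (N + i)" using c by (simp add: L_def)
    then show ?thesis using x(1)[of i] i(2) by (simp add: annihilator_iff)
  qed
  then have "y \<in> ann C" using y(1) by (simp add: annihilator_iff)
  then have "y \<odot>\<^bsub>E\<^esub> e = \<zero>\<^bsub>E\<^esub>" by (rule perp_mem[OF e])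
  then show False using lim[OF N] x(2) r0(2) by auto
qed

end


section \<open>The injective hull of the residue field\<close>

text \<open>The extension property is stated for modules with elements in \<open>'a \<times> 'e\<close>, so the
  ideals are copied there, with second component zero.\<close>

lemma injective_module_imp_baer:
  fixes R :: "('a, 'r) ring_scheme" (structure) and E :: "('a, 'e, 's) module_scheme"
  assumes inj: "injective_module R E" and K: "ideal K R"
    and f: "f \<in> K \<rightarrow> carrier E"
    and add: "\<And>x y. x \<in> K \<Longrightarrow> y \<in> K \<Longrightarrow> f (x \<oplus> y) = f x \<oplus>\<^bsub>E\<^esub> f y"
    and smult: "\<And>a x. a \<in> carrier R \<Longrightarrow> x \<in> K \<Longrightarrow> f (a \<otimes> x) = a \<odot>\<^bsub>E\<^esub> f x"
  shows "\<exists>e\<in>carrier E. \<forall>x\<in>K. f x = x \<odot>\<^bsub>E\<^esub> e"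
proof -
  interpret module R E using inj by (simp add: injective_module_def)
  interpret K: ideal K R by (rule K)
  let ?z = "\<zero>\<^bsub>E\<^esub>"
  define mod_of :: "'a set \<Rightarrow> ('a, 'a \<times> 'e) module" where
    "mod_of L = \<lparr>carrier = L \<times> {?z}, monoid.mult = undefined, one = undefined, ring.zero = (\<zero>, ?z),
       ring.add = (\<lambda>p q. (fst p \<oplus> fst q, ?z)), smult = (\<lambda>a p. (a \<otimes> fst p, ?z))\<rparr>" for L
  have mod_of: "module R (mod_of L)" if L: "ideal L R" for L
  proof -
    interpret L: ideal L R by (rule L)
    show ?thesis
    proof (intro moduleI abelian_groupI R.is_cring)
      fix p assume p: "p \<in> carrier (mod_of L)"
      show "\<exists>q\<in>carrier (mod_of L). q \<oplus>\<^bsub>mod_of L\<^esub> p = \<zero>\<^bsub>mod_of L\<^esub>"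
        using p by (intro bexI[of _ "(\<ominus> fst p, ?z)"]) (auto simp: mod_of_def R.l_neg)
    qed (auto simp: mod_of_def R.a_ac R.l_distr R.r_distr R.m_assoc L.I_l_closed)
  qed
  have "\<exists>g\<in>module_hom R (mod_of (carrier R)) E. \<forall>p\<in>carrier (mod_of K). g (id p) = (f \<circ> fst) p"
  proof (rule inj[unfolded injective_module_def, THEN conjunct2, rule_format], intro conjI)
    show "module R (mod_of K)" "module R (mod_of (carrier R))"
      by (intro mod_of K R.oneideal)+
    show "id \<in> module_hom R (mod_of K) (mod_of (carrier R))"
      by (auto simp: module_hom_def mod_of_def)
    show "f \<circ> fst \<in> module_hom R (mod_of K) E"
      using f by (auto simp: module_hom_def mod_of_def add smult)
  qed simp
  then obtain g where g: "g \<in> module_hom R (mod_of (carrier R)) E" and gf: "\<And>x. x \<in> K \<Longrightarrow> g (x, ?z) = f x"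
    by (auto simp: mod_of_def)
  have one: "(\<one>, ?z) \<in> carrier (mod_of (carrier R))" by (simp add: mod_of_def)
  have "f x = x \<odot>\<^bsub>E\<^esub> g (\<one>, ?z)" if x: "x \<in> K" for x
  proof -
    have "(x, ?z) = x \<odot>\<^bsub>mod_of (carrier R)\<^esub> (\<one>, ?z)" using K.Icarr[OF x] by (simp add: mod_of_def)
    then have "g (x, ?z) = x \<odot>\<^bsub>E\<^esub> g (\<one>, ?z)"
      using g one K.Icarr[OF x] unfolding module_hom_def by simp
    then show ?thesis using gf[OF x] by simp
  qed
  moreover have "g (\<one>, ?z) \<in> carrier E" using g one unfolding module_hom_def by blast
  ultimately show ?thesis by blast
qed

text \<open>The image of the residue field is generated by the image \<open>s\<close> of \<open>1\<close>, which has annihilator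
  \<open>m\<close>. A socle element \<open>t \<noteq> 0\<close> lies in this image: \<open>Rt\<close> meets it in some \<open>rt \<noteq> 0\<close>, where
  \<open>r \<notin> m\<close> is invertible.\<close>

theorem injective_hull_imp_matlis_module:
  fixes R :: "('a, 'r) ring_scheme" (structure) and E :: "('a, 'e, 's) module_scheme"
  assumes R: "complete_noetherian_local_ring R m"
    and E: "injective_hull R (quotient_module R m) E"
  shows "matlis_module R m E"
proof -
  have inj: "injective_module R E" using E by (simp add: injective_hull_def)
  interpret module R E using inj by (simp add: injective_module_def)
  interpret complete_noetherian_local_ring R m by (rule R)
  interpret m: ideal m R by (rule m_ideal)
  let ?k = "quotient_module R m"
  obtain f where f: "f \<in> module_hom R ?k E" "inj_on f (carrier ?k)"
    and ess: "\<And>N. submodule N R E \<Longrightarrow> N \<noteq> {\<zero>\<^bsub>E\<^esub>} \<Longrightarrow> N \<inter> f ` carrier ?k \<noteq> {\<zero>\<^bsub>E\<^esub>}"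
    using E unfolding injective_hull_def by blast
  have kc: "carrier ?k = {m +> x |x. x \<in> carrier R}"
    by (auto simp: quotient_module_def ring.defs module.defs FactRing_def A_RCOSETS_def' a_r_coset_def')
  have ks: "a \<odot>\<^bsub>?k\<^esub> (m +> x) = m +> (a \<otimes> x)" if "a \<in> carrier R" "x \<in> carrier R" for a x
    using that by (simp add: quotient_module_def ring.defs module.defs FactRing_def m.rcoset_mult_add)
  define s where "s = f (m +> \<one>)"
  have k1: "m +> \<one> \<in> carrier ?k" unfolding kc by blast
  have s: "s \<in> carrier E" using f(1) k1 unfolding s_def module_hom_def by blast
  have fs: "f (m +> x) = x \<odot>\<^bsub>E\<^esub> s" if x: "x \<in> carrier R" for x
  proof -
    have "f (x \<odot>\<^bsub>?k\<^esub> (m +> \<one>)) = x \<odot>\<^bsub>E\<^esub> s"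
      using f(1) k1 x unfolding s_def module_hom_def by blast
    then show ?thesis using ks[of x \<one>] x by simp
  qed
  have fz: "x \<odot>\<^bsub>E\<^esub> s = \<zero>\<^bsub>E\<^esub> \<longleftrightarrow> x \<in> m" if x: "x \<in> carrier R" for x
  proof -
    have "x \<odot>\<^bsub>E\<^esub> s = \<zero>\<^bsub>E\<^esub> \<longleftrightarrow> f (m +> x) = f (m +> \<zero>)" using fs x s by simp
    also have "\<dots> \<longleftrightarrow> m +> x = m +> \<zero>"
      using f(2) x by (intro inj_on_eq_iff) (auto simp: kc)
    also have "\<dots> \<longleftrightarrow> x \<ominus> \<zero> \<in> m"
      using x R.quotient_eq_iff_same_a_r_cos[OF m_ideal x R.zero_closed] by simp
    finally show ?thesis using x by (simp add: a_minus_def)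
  qed
  have ms: "a \<odot>\<^bsub>E\<^esub> s = \<zero>\<^bsub>E\<^esub>" if "a \<in> m" for a using fz that m_carr by blast
  have ms': "a \<odot>\<^bsub>E\<^esub> (x \<odot>\<^bsub>E\<^esub> s) = \<zero>\<^bsub>E\<^esub>" if "a \<in> m" "x \<in> carrier R" for a x
    using that smult_lcomm[OF m_carr[OF that(1)] that(2) s] ms by simp
  have ess': "\<exists>x\<in>carrier R. x \<odot>\<^bsub>E\<^esub> s \<in> N \<and> x \<odot>\<^bsub>E\<^esub> s \<noteq> \<zero>\<^bsub>E\<^esub>"
    if N: "submodule N R E" "N \<noteq> {\<zero>\<^bsub>E\<^esub>}" for N
  proof -
    have "\<zero>\<^bsub>E\<^esub> \<in> N" using subgroup.one_closed[OF submodule.axioms(1)[OF N(1)]] by simp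
    moreover have "\<zero>\<^bsub>E\<^esub> = f (m +> \<zero>)" using fs s by simp
    then have "\<zero>\<^bsub>E\<^esub> \<in> f ` carrier ?k" unfolding kc by blast
    ultimately obtain t where "t \<in> N" "t \<in> f ` carrier ?k" "t \<noteq> \<zero>\<^bsub>E\<^esub>" using ess[OF N] by blast
    then show ?thesis unfolding kc using fs by auto
  qed
  have multiple: "\<exists>u\<in>carrier R. t = u \<odot>\<^bsub>E\<^esub> s"
    if t: "t \<in> carrier E" "\<forall>a\<in>m. a \<odot>\<^bsub>E\<^esub> t = \<zero>\<^bsub>E\<^esub>" for t
  proof (cases "t = \<zero>\<^bsub>E\<^esub>")
    case True
    then show ?thesis using s by (intro bexI[of _ \<zero>]) auto
  next
    case False
    let ?N = "{r \<odot>\<^bsub>E\<^esub> t |r. r \<in> carrier R}"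
    have "\<one> \<odot>\<^bsub>E\<^esub> t \<in> ?N" by blast
    then have "?N \<noteq> {\<zero>\<^bsub>E\<^esub>}" using False t(1) by (metis singletonD smult_one)
    from ess'[OF cyclic_submodule[OF t(1)] this] obtain x r where
      x: "x \<in> carrier R" "x \<odot>\<^bsub>E\<^esub> s \<noteq> \<zero>\<^bsub>E\<^esub>" and r: "r \<in> carrier R" "x \<odot>\<^bsub>E\<^esub> s = r \<odot>\<^bsub>E\<^esub> t" by blast
    have "r \<notin> m" using t(2) x(2) r(2) by auto
    then obtain v where v: "v \<in> carrier R" "v \<otimes> r = \<one>" using notin_m_invertible[OF r(1)] by blast
    have "t = (v \<otimes> r) \<odot>\<^bsub>E\<^esub> t" using v t(1) by simp
    also have "\<dots> = v \<odot>\<^bsub>E\<^esub> (x \<odot>\<^bsub>E\<^esub> s)" using v(1) r t(1) by (simp add: smult_assoc1)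
    also have "\<dots> = (v \<otimes> x) \<odot>\<^bsub>E\<^esub> s" using v(1) x(1) s by (simp add: smult_assoc1)
    finally show ?thesis using v(1) x(1) by blast
  qed
  show ?thesis
  proof unfold_locales
    have "s \<noteq> \<zero>\<^bsub>E\<^esub>" using fz[of \<one>] one_notin_m s by simp
    then show "\<exists>s\<in>carrier E. s \<noteq> \<zero>\<^bsub>E\<^esub> \<and> (\<forall>a\<in>m. a \<odot>\<^bsub>E\<^esub> s = \<zero>\<^bsub>E\<^esub>)" using s ms by blast
  next
    fix N assume "submodule N R E" "N \<noteq> {\<zero>\<^bsub>E\<^esub>}"
    then show "\<exists>t\<in>N. t \<noteq> \<zero>\<^bsub>E\<^esub> \<and> (\<forall>a\<in>m. a \<odot>\<^bsub>E\<^esub> t = \<zero>\<^bsub>E\<^esub>)" using ess' ms' by blast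
  next
    fix t t' assume t: "t \<in> carrier E" "t \<noteq> \<zero>\<^bsub>E\<^esub>" "\<forall>a\<in>m. a \<odot>\<^bsub>E\<^esub> t = \<zero>\<^bsub>E\<^esub>"
      and t': "t' \<in> carrier E" "\<forall>a\<in>m. a \<odot>\<^bsub>E\<^esub> t' = \<zero>\<^bsub>E\<^esub>"
    obtain u where u: "u \<in> carrier R" "t = u \<odot>\<^bsub>E\<^esub> s" using multiple[OF t(1,3)] by blast
    obtain u' where u': "u' \<in> carrier R" "t' = u' \<odot>\<^bsub>E\<^esub> s" using multiple[OF t'] by blast
    have "u \<notin> m" using t(2) u(2) ms by blast
    then obtain v where v: "v \<in> carrier R" "v \<otimes> u = \<one>" using notin_m_invertible[OF u(1)] by blast
    have "s = (v \<otimes> u) \<odot>\<^bsub>E\<^esub> s" using v s by simp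
    also have "\<dots> = v \<odot>\<^bsub>E\<^esub> t" using v(1) u s by (simp add: smult_assoc1)
    finally have "t' = (u' \<otimes> v) \<odot>\<^bsub>E\<^esub> t" using u' v(1) t(1) by (simp add: smult_assoc1)
    then show "\<exists>u\<in>carrier R. t' = u \<odot>\<^bsub>E\<^esub> t" using u'(1) v(1) by blast
  next
    fix K f assume "ideal K R" "f \<in> K \<rightarrow> carrier E"
      "\<And>x y. x \<in> K \<Longrightarrow> y \<in> K \<Longrightarrow> f (x \<oplus> y) = f x \<oplus>\<^bsub>E\<^esub> f y"
      "\<And>a x. a \<in> carrier R \<Longrightarrow> x \<in> K \<Longrightarrow> f (a \<otimes> x) = a \<odot>\<^bsub>E\<^esub> f x"
    then show "\<exists>e\<in>carrier E. \<forall>x\<in>K. f x = x \<odot>\<^bsub>E\<^esub> e"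
      by (rule injective_module_imp_baer[OF inj])
  qed
qed


section \<open>Integral hulls and basically full closures\<close>

context matlis_module
begin

lemma noetherian: "noetherian_ring R"
  by (rule noetherian_ring_axioms)

text \<open>Duality loses no information about the two integral closures, as these are ideals.\<close>

lemma integral_interior_eq_iff:
  assumes I: "ideal I R" and JI: "ideal J R" "J \<subseteq> I"
  shows "integral_interior R E (perp J) = integral_interior R E (perp I) \<longleftrightarrow> reduction R J I"
proof -
  note cl = R.integral_closure_ideal[OF noetherian]
  have "integral_interior R E (perp J) = integral_interior R E (perp I) \<longleftrightarrow>
      perp (integral_closure R J) = perp (integral_closure R I)"
    unfolding integral_interior_def ann_perp[OF JI(1)] ann_perp[OF I] ..
  also have "\<dots> \<longleftrightarrow> integral_closure R J = integral_closure R I"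
    using ann_perp[OF cl[OF JI(1)]] ann_perp[OF cl[OF I]] by metis
  finally show ?thesis
    using R.reduction_iff_integral_closure_eq[OF noetherian JI(1) I JI(2)] by simp
qed

text \<open>Under duality the submodules in the sum that defines the integral hull are the
  \<open>(0 :\<^sub>E J)\<close> for the reductions \<open>J\<close> of \<open>I\<close>, and a sum of submodules is dual to the intersection of
  their annihilators.\<close>

theorem integral_hull_perp:
  assumes I: "ideal I R"
  shows "integral_hull R E (perp I) = perp (core R I)"
proof -
  let ?F = "{C. submodule C R E \<and> perp I \<subseteq> C \<and> integral_interior R E C = integral_interior R E (perp I)}"
  have F: "?F = perp ` {J. reduction R J I}"
  proof (intro equalityI subsetI)
    fix C assume C: "C \<in> ?F"
    have "ideal (ann C) R" using C by (intro annihilator_ideal submoduleE(1)) auto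
    moreover have "ann C \<subseteq> I" using annihilator_antimono[of "perp I" C] C ann_perp[OF I] by auto
    moreover have pC: "perp (ann C) = C" using C by (intro perp_ann) auto
    ultimately have "reduction R (ann C) I" using C integral_interior_eq_iff[OF I, of "ann C"] by simp
    then show "C \<in> perp ` {J. reduction R J I}" using pC by blast
  next
    fix C assume "C \<in> perp ` {J. reduction R J I}"
    then obtain J where J: "reduction R J I" "C = perp J" by blast
    have JI: "ideal J R" "J \<subseteq> I" "J \<subseteq> carrier R"
      using J(1) ideal.Icarr[OF I] by (auto simp: reduction_def)
    show "C \<in> ?F"
      using integral_interior_eq_iff[OF I JI(1,2)] J annihilated_by_submodule[OF JI(3)]
        annihilated_by_antimono[OF JI(2)] by auto
  qed
  have Fc: "\<Union>?F \<subseteq> carrier E" using submoduleE(1) by blast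
  have "ann (\<Union>?F) = core R I"
  proof (intro equalityI subsetI)
    fix a assume a: "a \<in> ann (\<Union>?F)"
    have "a \<in> J" if J: "reduction R J I" for J
    proof -
      have "a \<in> ann (perp J)" using a J unfolding F annihilator_def by blast
      then show ?thesis using ann_perp[of J] J by (auto simp: reduction_def)
    qed
    then show "a \<in> core R I" by (simp add: core_def)
  next
    fix a assume "a \<in> core R I"
    then have a: "a \<in> J" if "reduction R J I" for J using that by (auto simp: core_def)
    have "a \<in> carrier R" using a[OF R.reduction_refl[OF I]] ideal.Icarr[OF I] by blast
    moreover have "a \<odot>\<^bsub>E\<^esub> e = \<zero>\<^bsub>E\<^esub>" if "e \<in> \<Union>?F" for e
      using that a perp_mem unfolding F by blast
    ultimately show "a \<in> ann (\<Union>?F)" by (simp add: annihilator_iff)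
  qed
  then show ?thesis
    unfolding integral_hull_def
    using perp_ann[OF submodule_generated_submodule[OF Fc]] annihilator_submodule_generated[OF Fc] by simp
qed

lemma ideal_times_perp:
  assumes I: "ideal I R" and K: "ideal K R"
  shows "ideal_times_submodule R E I (perp K) = perp (ideal_colon R K I)"
proof -
  let ?S = "{a \<odot>\<^bsub>E\<^esub> z |a z. a \<in> I \<and> z \<in> perp K}"
  note Ic = ideal.Icarr[OF I]
  have S: "?S \<subseteq> carrier E" using Ic perp_carr by auto
  have "ann ?S = ideal_colon R K I"
  proof (intro equalityI subsetI)
    fix r assume r: "r \<in> ann ?S"
    have rc: "r \<in> carrier R" using r by (simp add: annihilator_iff)
    have "a \<otimes> r \<in> ann (perp K)" if a: "a \<in> I" for a
    proof -
      have "(a \<otimes> r) \<odot>\<^bsub>E\<^esub> z = \<zero>\<^bsub>E\<^esub>" if z: "z \<in> perp K" for z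
      proof -
        have "r \<odot>\<^bsub>E\<^esub> (a \<odot>\<^bsub>E\<^esub> z) = \<zero>\<^bsub>E\<^esub>" using r a z unfolding annihilator_def by blast
        then show ?thesis
          using smult_lcomm[OF rc Ic[OF a] perp_carr[OF z]] rc Ic[OF a] perp_carr[OF z]
          by (simp add: smult_assoc1)
      qed
      then show ?thesis using rc Ic[OF a] by (simp add: annihilator_iff)
    qed
    then show "r \<in> ideal_colon R K I" unfolding ann_perp[OF K] using rc by (simp add: ideal_colon_def)
  next
    fix r assume r: "r \<in> ideal_colon R K I"
    have rc: "r \<in> carrier R" using r by (simp add: ideal_colon_def)
    have "r \<odot>\<^bsub>E\<^esub> (a \<odot>\<^bsub>E\<^esub> z) = \<zero>\<^bsub>E\<^esub>" if a: "a \<in> I" and z: "z \<in> perp K" for a z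
    proof -
      have "(a \<otimes> r) \<odot>\<^bsub>E\<^esub> z = \<zero>\<^bsub>E\<^esub>" using r a by (intro perp_mem[OF z]) (simp add: ideal_colon_def)
      then show ?thesis
        using smult_lcomm[OF rc Ic[OF a] perp_carr[OF z]] rc Ic[OF a] perp_carr[OF z]
        by (simp add: smult_assoc1)
    qed
    then show "r \<in> ann ?S" unfolding annihilator_def using rc by blast
  qed
  then show ?thesis
    unfolding ideal_times_submodule_def
    using perp_ann[OF submodule_generated_submodule[OF S]] annihilator_submodule_generated[OF S] by simp
qed

lemma module_colon_perp:
  assumes I: "ideal I R" and Q: "ideal Q R"
  shows "module_colon R E (perp Q) I = perp (I \<cdot> Q)"
proof (intro equalityI subsetI)
  note Ic = ideal.Icarr[OF I] and Qc = ideal.Icarr[OF Q]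
  fix z assume z: "z \<in> module_colon R E (perp Q) I"
  have zc: "z \<in> carrier E" using z by (simp add: module_colon_def)
  have "I \<cdot> Q \<subseteq> ann {z}"
  proof (intro R.ideal_prod_least annihilator_ideal)
    fix a q assume a: "a \<in> I" and q: "q \<in> Q"
    have "a \<odot>\<^bsub>E\<^esub> z \<in> perp Q" using z a by (simp add: module_colon_def[of _ _ "perp Q"])
    then have "q \<odot>\<^bsub>E\<^esub> (a \<odot>\<^bsub>E\<^esub> z) = \<zero>\<^bsub>E\<^esub>" by (rule perp_mem[OF _ q])
    then show "a \<otimes> q \<in> ann {z}"
      using Ic[OF a] Qc[OF q] zc smult_lcomm[OF Qc[OF q] Ic[OF a] zc]
      by (simp add: annihilator_iff smult_assoc1)
  qed (use zc in simp)
  then show "z \<in> perp (I \<cdot> Q)" using zc unfolding annihilator_def annihilated_by_iff by blast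
next
  note Ic = ideal.Icarr[OF I] and Qc = ideal.Icarr[OF Q]
  fix z assume z: "z \<in> perp (I \<cdot> Q)"
  have zc: "z \<in> carrier E" using perp_carr[OF z] .
  have "q \<odot>\<^bsub>E\<^esub> (a \<odot>\<^bsub>E\<^esub> z) = \<zero>\<^bsub>E\<^esub>" if a: "a \<in> I" and q: "q \<in> Q" for a q
    using perp_mem[OF z ideal_prod.prod[OF a q]] Ic[OF a] Qc[OF q] zc
      smult_lcomm[OF Qc[OF q] Ic[OF a] zc] by (simp add: smult_assoc1)
  then have "a \<odot>\<^bsub>E\<^esub> z \<in> perp Q" if "a \<in> I" for a
    using that Ic[OF that] zc by (simp add: annihilated_by_iff)
  then show "z \<in> module_colon R E (perp Q) I" using zc unfolding module_colon_def[of _ _ "perp Q"] by blast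
qed

text \<open>Multiplying a submodule by \<open>I\<close> is dual to the quotient of an ideal by \<open>I\<close>, and the
  quotient of a submodule by \<open>I\<close> is dual to multiplying an ideal by \<open>I\<close>. The basically full closure
  does one after the other.\<close>

theorem basically_full_closure_perp:
  assumes I: "ideal I R" and K: "ideal K R"
  shows "basically_full_closure R E I (perp K) = perp (I \<cdot> ideal_colon R K I)"
proof -
  have "ideal (ideal_colon R K I) R"
    using ideal.Icarr[OF I] by (intro R.ideal_colon_ideal[OF K]) blast
  then show ?thesis
    unfolding basically_full_closure_def ideal_times_perp[OF I K] by (rule module_colon_perp[OF I])
qed

end


theorem theorem7p11:
  fixes R :: "('a, 'r) ring_scheme" and m I J :: "'a set"
    and E :: "('a, 'e, 's) module_scheme"
    and l g r n :: nat
  assumes "complete_noetherian_local_ring R m"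
    and "injective_hull R (quotient_module R m) E"
    and "ideal I R"
    and "analytic_spread R m I = enat l"
    and "ideal_height R I = enat g"
    and "reduction R J I"
    and "reduction_number R J I = r"
    and "int n \<ge> max (int r - int l + int g + 1) 1"
    and "core R I =
           I \<cdot>\<^bsub>R\<^esub> ideal_colon R (ideal_power R J n) (ideal_power R I n)"
  shows "integral_hull R E (annihilated_by R E I) =
           basically_full_closure R E I
             (annihilated_by R E (ideal_colon R (ideal_power R J n) (ideal_power R I (n - 1))))"
proof -
  interpret matlis_module R m E
    by (rule injective_hull_imp_matlis_module[OF assms(1,2)])
  note I = assms(3) and pow = R.ideal_power_ideal
  have J: "ideal J R" using assms(6) by (simp add: reduction_def)
  obtain k where k: "n = Suc k" using assms(8) by (cases n) auto
  have K: "ideal (ideal_colon R (ideal_power R J n) (ideal_power R I k)) R"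
    using ideal.Icarr[OF pow[OF I]] by (intro R.ideal_colon_ideal pow[OF J]) blast
  have "ideal_colon R (ideal_colon R (ideal_power R J n) (ideal_power R I k)) I =
      ideal_colon R (ideal_power R J n) (ideal_power R I n)"
    unfolding k R.ideal_power_Suc[of I] by (intro R.ideal_colon_colon pow I J)
  then have "basically_full_closure R E I (perp (ideal_colon R (ideal_power R J n) (ideal_power R I k))) =
      perp (core R I)"
    unfolding assms(9) basically_full_closure_perp[OF I K] by simp
  then show ?thesis
    unfolding integral_hull_perp[OF I] k by simp
qed

end
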